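(* Let $2\le Q\le7$ be an integer. For $n$ sufficiently large let $v_n\in\ell^2$ be the Perron Frobenius eigenvector of $A_{Y_n}$, normalized by $v_n(0)=1$, where $Y_n$ is the graph obtained from $\mathbb G^Q$ by adding one self-loop at each of the $n+1$ vertices $0,1,\dots,n$ of $\mathbb N\subset\mathbb G^Q$. Then $v_n$ converges pointwise, as $n\to\infty$, to a weight $v$ which is a (generalized) Perron Frobenius eigenvector of $A_{\mathbb H^Q}$. It is given by $$v(x)=a(\lambda_* )^{d(x,\mathbb N)}\big[y(x)(1-a(\lambda_* ))+1\big],\qquad x\in\mathbb G^Q,$$ where $y(x)\in\mathbb N$ is the unique vertex of $\mathbb N$ with $d(x,y(x))=d(x,\mathbb N)$ (regarded as a nonnegative integer), $\lambda_*=\frac{3-\sqrt5}{2}Q+\sqrt5$, and $$a(\lambda)=\frac{1-\sqrt{1-\frac{4(Q-1)}{\lambda^2}}}{\frac{2(Q-1)}{\lambda}}.$$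
   Context: For a graph $X$ (undirected, self-loops allowed) the adjacency operator $A_X$ acts on $\ell^2(VX)$ and its matrix entry $A_{xy}$ is the number of edges joining $x$ and $y$; a single self-loop at $x$ contributes $A_{xx}=1$. $\mathbb G^Q$ is the homogeneous Cayley tree of order $Q$ (the infinite tree in which every vertex has degree $Q$), with a fixed root $0$ and graph distance $d$. $\mathbb H^Q$ is the graph obtained from $\mathbb G^Q$ by adding one self-loop at each vertex of a fixed one-sided infinite path (without repeated vertices) starting from the root $0$; this path is identified with $\mathbb N=\{0,1,2,\dots\}$, consecutive integers being adjacent and the root corresponding to $0$. For a bounded operator $B$ on $\ell^2(VX)$ with nonnegative entries, a (generalized) Perron Frobenius eigenvector is a family $\{v(x)\}_{x\in VX}$ with positive entries, not necessarily in $\ell^2$, such that $\sum_{y}B_{xy}v(y)=\|B\|v(x)$ for all $x\in VX$. *)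

theory Defs
  imports "HOL-Analysis.Analysis"
begin

section \<open>Undirected graphs\<close>

text \<open>
  An edge is the set of its endpoints: \<open>{x, y}\<close> with \<open>x \<noteq> y\<close> is an ordinary edge and \<open>{x}\<close> is a
  self-loop at \<open>x\<close>. Parallel edges are not represented; none of the graphs considered here
  has any.
\<close>

record 'a ugraph =
  verts :: "'a set"
  edges :: "'a set set"

definition wf_ugraph :: "'a ugraph \<Rightarrow> bool" where
  "wf_ugraph X \<longleftrightarrow> (\<forall>e\<in>edges X. \<exists>x\<in>verts X. \<exists>y\<in>verts X. e = {x, y})"

definition walk :: "'a ugraph \<Rightarrow> 'a list \<Rightarrow> bool" where
  "walk X xs \<longleftrightarrow> xs \<noteq> [] \<and> set xs \<subseteq> verts X \<and> successively (\<lambda>x y. {x, y} \<in> edges X) xs"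

definition connected_ugraph :: "'a ugraph \<Rightarrow> bool" where
  "connected_ugraph X \<longleftrightarrow> verts X \<noteq> {} \<and>
     (\<forall>x\<in>verts X. \<forall>y\<in>verts X. \<exists>xs. walk X xs \<and> hd xs = x \<and> last xs = y)"

definition cycle :: "'a ugraph \<Rightarrow> 'a list \<Rightarrow> bool" where
  "cycle X xs \<longleftrightarrow> walk X xs \<and> distinct xs \<and> length xs \<ge> 3 \<and> {last xs, hd xs} \<in> edges X"

definition tree :: "'a ugraph \<Rightarrow> bool" where
  "tree X \<longleftrightarrow> wf_ugraph X \<and> connected_ugraph X \<and>
     (\<forall>x. {x} \<notin> edges X) \<and> (\<nexists>xs. cycle X xs)"

text \<open>
  For \<open>Q \<ge> 2\<close> such a tree is automatically infinite, and it is unique up to isomorphism.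
\<close>

definition homogeneous_tree :: "nat \<Rightarrow> 'a ugraph \<Rightarrow> bool" where
  "homogeneous_tree Q X \<longleftrightarrow> tree X \<and> (\<forall>x\<in>verts X. card {e \<in> edges X. x \<in> e} = Q)"

definition gdist :: "'a ugraph \<Rightarrow> 'a \<Rightarrow> 'a \<Rightarrow> nat" where
  "gdist X x y = (LEAST n. \<exists>xs. walk X xs \<and> hd xs = x \<and> last xs = y \<and> length xs = Suc n)"

definition ray :: "'a ugraph \<Rightarrow> (nat \<Rightarrow> 'a) \<Rightarrow> bool" where
  "ray X p \<longleftrightarrow> range p \<subseteq> verts X \<and> inj p \<and> (\<forall>k. {p k, p (Suc k)} \<in> edges X)"

definition add_loops :: "'a ugraph \<Rightarrow> 'a set \<Rightarrow> 'a ugraph" where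
  "add_loops X S = X\<lparr>edges := edges X \<union> {{x} | x. x \<in> S}\<rparr>"

definition adjacency :: "'a ugraph \<Rightarrow> 'a \<Rightarrow> 'a \<Rightarrow> real" where
  "adjacency X x y = real (card {e \<in> edges X. e = {x, y}})"


section \<open>Operators on \<open>\<ell>\<^sup>2\<close> of a set, given by real matrices\<close>

text \<open>
  The complex Hilbert space \<open>\<ell>\<^sup>2(V)\<close>: only the values on \<open>V\<close> of a function matter.
\<close>

definition l2 :: "'a set \<Rightarrow> ('a \<Rightarrow> complex) set" where
  "l2 V = {f. (\<lambda>x. (cmod (f x))\<^sup>2) summable_on V}"

definition l2_norm :: "'a set \<Rightarrow> ('a \<Rightarrow> complex) \<Rightarrow> real" where
  "l2_norm V f = sqrt (\<Sum>\<^sub>\<infinity>x\<in>V. (cmod (f x))\<^sup>2)"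

definition mat_apply :: "'a set \<Rightarrow> ('a \<Rightarrow> 'a \<Rightarrow> real) \<Rightarrow> ('a \<Rightarrow> complex) \<Rightarrow> 'a \<Rightarrow> complex" where
  "mat_apply V B f = (\<lambda>x. \<Sum>\<^sub>\<infinity>y\<in>V. complex_of_real (B x y) * f y)"

definition l2_bounded :: "'a set \<Rightarrow> ('a \<Rightarrow> 'a \<Rightarrow> real) \<Rightarrow> bool" where
  "l2_bounded V B \<longleftrightarrow>
     (\<forall>f\<in>l2 V. (\<forall>x\<in>V. (\<lambda>y. complex_of_real (B x y) * f y) summable_on V) \<and>
               mat_apply V B f \<in> l2 V) \<and>
     (\<exists>C. \<forall>f\<in>l2 V. l2_norm V (mat_apply V B f) \<le> C * l2_norm V f)"

definition op_norm :: "'a set \<Rightarrow> ('a \<Rightarrow> 'a \<Rightarrow> real) \<Rightarrow> real" where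
  "op_norm V B = Sup {l2_norm V (mat_apply V B f) | f. f \<in> l2 V \<and> l2_norm V f \<le> 1}"

text \<open>
  Generalized Perron Frobenius eigenvectors; they need not lie in \<open>\<ell>\<^sup>2(V)\<close>. Boundedness of the
  operator is part of the predicate, so that \<^const>\<open>op_norm\<close> is a genuine supremum.
\<close>

definition PF_eigenvector :: "'a set \<Rightarrow> ('a \<Rightarrow> 'a \<Rightarrow> real) \<Rightarrow> ('a \<Rightarrow> real) \<Rightarrow> bool" where
  "PF_eigenvector V B v \<longleftrightarrow>
     l2_bounded V B \<and> (\<forall>x\<in>V. \<forall>y\<in>V. B x y \<ge> 0) \<and> (\<forall>x\<in>V. v x > 0) \<and>
     (\<forall>x\<in>V. ((\<lambda>y. B x y * v y) has_sum (op_norm V B * v x)) V)"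

definition normalized_l2_PF :: "'a ugraph \<Rightarrow> 'a \<Rightarrow> ('a \<Rightarrow> real) \<Rightarrow> bool" where
  "normalized_l2_PF X r v \<longleftrightarrow>
     PF_eigenvector (verts X) (adjacency X) v \<and> (\<lambda>x. complex_of_real (v x)) \<in> l2 (verts X) \<and>
     v r = 1"


section \<open>The perturbed trees and the limit weight\<close>

text \<open>
  The path \<open>\<nat>\<close> in the tree is given by a ray \<open>p\<close>, the integer \<open>k\<close> being identified with the
  vertex \<open>p k\<close>; the root is \<open>p 0\<close>.
\<close>

definition graph_Y :: "'a ugraph \<Rightarrow> (nat \<Rightarrow> 'a) \<Rightarrow> nat \<Rightarrow> 'a ugraph" where
  "graph_Y G p n = add_loops G (p ` {0..n})"

definition graph_H :: "'a ugraph \<Rightarrow> (nat \<Rightarrow> 'a) \<Rightarrow> 'a ugraph" where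
  "graph_H G p = add_loops G (range p)"

definition dist_ray :: "'a ugraph \<Rightarrow> (nat \<Rightarrow> 'a) \<Rightarrow> 'a \<Rightarrow> nat" where
  "dist_ray G p x = (INF k. gdist G x (p k))"

definition foot :: "'a ugraph \<Rightarrow> (nat \<Rightarrow> 'a) \<Rightarrow> 'a \<Rightarrow> nat" where
  "foot G p x = (THE k. gdist G x (p k) = dist_ray G p x)"

definition lambda_star :: "nat \<Rightarrow> real" where
  "lambda_star Q = (3 - sqrt 5) / 2 * real Q + sqrt 5"

definition a_fun :: "nat \<Rightarrow> real \<Rightarrow> real" where
  "a_fun Q l = (1 - sqrt (1 - 4 * (real Q - 1) / l\<^sup>2)) / (2 * (real Q - 1) / l)"

definition limit_weight :: "nat \<Rightarrow> 'a ugraph \<Rightarrow> (nat \<Rightarrow> 'a) \<Rightarrow> 'a \<Rightarrow> real" where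
  "limit_weight Q G p x =
     a_fun Q (lambda_star Q) ^ dist_ray G p x *
     (real (foot G p x) * (1 - a_fun Q (lambda_star Q)) + 1)"

end

theory Submission
  imports Defs "HOL-Real_Asymp.Real_Asymp"
begin

text \<open>
  Put \<open>q = Q - 1\<close>. A function of the form \<open>v(x) = a\<^sup>d y(k)\<close>, where \<open>d\<close> is the distance of \<open>x\<close> to the
  ray and \<open>k\<close> its foot, satisfies the eigenvalue equation off the ray exactly for the eigenvalue
  \<open>1/a + q a\<close>, and on the ray the equation becomes a three-term recurrence for \<open>y\<close>. With loops at
  \<open>0,\<dots>,n\<close> and \<open>1/a + a = 1 + 2 cos \<theta>\<close>, it is solved by \<open>y(k) = cos (\<theta> (k - n/2))\<close> up to \<open>n\<close> and by
  geometric decay beyond, provided \<open>cos (\<theta> (n/2 + 1)) = a cos (\<theta> n/2)\<close>; the intermediate value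
  theorem yields such a \<open>\<theta>\<close> in \<open>(0, \<pi>/(n + 2))\<close>. As \<open>\<theta> \<rightarrow> 0\<close>, \<open>a\<close> tends to \<open>(3 - \<surd>5)/2\<close>, and \<open>Q \<le> 7\<close>
  means precisely that \<open>q a\<^sup>2 < 1\<close> for this limit, which makes \<open>v\<close> square summable for large \<open>n\<close>. A
  positive eigenvector bounds the norm from above by the Schur test; a square summable one bounds
  it from below, for the perturbed graph itself and for every graph with more loops.
\<close>

section \<open>Paths in trees\<close>

lemma walk_Cons:
  "walk X (x # xs) \<longleftrightarrow> x \<in> verts X \<and> (xs = [] \<or> {x, hd xs} \<in> edges X \<and> walk X xs)"
  by (cases xs) (auto simp: walk_def)

lemma walk_append:
  assumes "xs \<noteq> []" "ys \<noteq> []"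
  shows "walk X (xs @ ys) \<longleftrightarrow> walk X xs \<and> walk X ys \<and> {last xs, hd ys} \<in> edges X"
  using assms by (auto simp: walk_def successively_append_iff)

lemma walk_rev [simp]: "walk X (rev xs) \<longleftrightarrow> walk X xs"
  by (simp add: walk_def insert_commute)

lemma walk_ne: "walk X xs \<Longrightarrow> xs \<noteq> []"
  by (simp add: walk_def)

text \<open>Induction on \<open>xs\<close>. If both paths leave \<open>x\<close> through the same
  vertex, drop \<open>x\<close>. Otherwise they must meet again because their ends agree, and the
  two arcs from \<open>x\<close> to the meeting point close up to a cycle.\<close>

lemma simple_path_unique:
  assumes acyclic: "\<nexists>c. cycle X c"
    and "walk X xs" "distinct xs" "walk X ys" "distinct ys" "hd xs = hd ys" "last xs = last ys"
  shows "xs = ys"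
  using assms(2-)
proof (induction xs arbitrary: ys)
  case Nil
  then show ?case by (simp add: walk_def)
next
  case (Cons x xs)
  obtain ys' where ys: "ys = x # ys'"
    using Cons.prems by (cases ys) (auto simp: walk_def)
  show ?case
  proof (cases "xs = [] \<or> ys' = []")
    case True
    then show ?thesis using Cons.prems ys
      by (metis distinct.simps(2) last.simps last_in_set)
  next
    case False
    then have ne: "xs \<noteq> []" "ys' \<noteq> []" by auto
    have last: "last ys' = last xs" using Cons.prems ys ne by simp
    show ?thesis
    proof (cases "hd xs = hd ys'")
      case True
      then show ?thesis using Cons.IH[of ys'] Cons.prems ys ne last by (simp add: walk_Cons)
    next
      case diff: False
      have "\<exists>z\<in>set ys'. z \<in> set xs" using last ne last_in_set by metis
      \<comment> \<open>\<open>z\<close> is the first vertex of \<open>ys'\<close> lying on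
        \<open>xs\<close>, so \<open>B\<close> avoids \<open>xs\<close>; this makes the loop through
        \<open>x\<close>, \<open>A\<close>, \<open>z\<close> and the reverse of \<open>B\<close>
        free of repetitions.\<close>
      then obtain B z C where B: "ys' = B @ z # C" "z \<in> set xs" "\<forall>b\<in>set B. b \<notin> set xs"
        by (elim split_list_first_propE)
      obtain A D where A: "xs = A @ z # D" using split_list[OF B(2)] by auto
      have "walk X ((x # A @ [z]) @ D)" using Cons.prems A by simp
      then have wA: "walk X (x # A @ [z])" by (cases "D = []") (auto simp: walk_append simp del: append_Cons)
      have "walk X ((x # B @ [z]) @ C)" using Cons.prems B ys by simp
      then have wB: "walk X (x # B @ [z])" by (cases "C = []") (auto simp: walk_append simp del: append_Cons)
      have "walk X (rev (x # B @ [z]))" using wB by (simp only: walk_rev)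
      then have "walk X ((z # rev B) @ [x])" by simp
      then have wB': "walk X (z # rev B)" "{last (z # rev B), x} \<in> edges X"
        using walk_append[of "z # rev B" "[x]" X] by auto
      have "walk X (x # A @ z # rev B)"
      proof (cases "B = []")
        case True
        then show ?thesis using wA by simp
      next
        case False
        then have "walk X (rev B)" "{z, hd (rev B)} \<in> edges X"
          using wB' by (auto simp: walk_Cons)
        then have "walk X ((x # A @ [z]) @ rev B)"
          using wA False by (subst walk_append) auto
        then show ?thesis by simp
      qed
      moreover have "distinct (x # A @ z # rev B)"
        using Cons.prems B A ys by auto
      \<comment> \<open>With \<open>A\<close> and \<open>B\<close> both empty the paths would share
        their second vertex \<open>z\<close>, so the loop never degenerates to an edge run back and
        forth.\<close>
      moreover have "length (x # A @ z # rev B) \<ge> 3"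
      proof -
        have "A \<noteq> [] \<or> B \<noteq> []" using diff A B by auto
        then show ?thesis by (cases A; cases B) auto
      qed
      ultimately have "cycle X (x # A @ z # rev B)"
        using wB' by (simp add: cycle_def)
      then show ?thesis using acyclic by blast
    qed
  qed
qed

text \<open>A walk of minimal length is simple: cutting out the part between two occurrences of a
  vertex \<open>b\<close> keeps the ends and shortens the walk.\<close>

lemma shortest_walk:
  assumes "connected_ugraph X" "x \<in> verts X" "y \<in> verts X"
  obtains xs where "walk X xs" "distinct xs" "hd xs = x" "last xs = y" "length xs = Suc (gdist X x y)"
proof -
  let ?P = "\<lambda>n. \<exists>xs. walk X xs \<and> hd xs = x \<and> last xs = y \<and> length xs = Suc n"
  obtain ws where "walk X ws" "hd ws = x" "last ws = y"
    using assms by (auto simp: connected_ugraph_def)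
  then have "?P (length ws - 1)" by (intro exI[of _ ws]) (auto simp: walk_def)
  then have "?P (gdist X x y)" unfolding gdist_def by (rule LeastI)
  then obtain xs where xs: "walk X xs" "hd xs = x" "last xs = y" "length xs = Suc (gdist X x y)"
    by auto
  have "distinct xs"
  proof (rule ccontr)
    assume "\<not> distinct xs"
    then obtain as bs cs b where dec: "xs = as @ [b] @ bs @ [b] @ cs"
      using not_distinct_decomp by blast
    have "walk X ((as @ [b]) @ (bs @ [b] @ cs))" using xs dec by simp
    then have w1: "walk X (as @ [b])" by (subst (asm) walk_append) auto
    have "walk X ((as @ [b] @ bs) @ (b # cs))" using xs dec by simp
    then have w2: "walk X (b # cs)" by (subst (asm) walk_append) auto
    have "walk X ((as @ [b]) @ cs)"
      using w1 w2 by (cases "cs = []") (auto simp: walk_append walk_Cons simp del: append_assoc)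
    moreover have "hd ((as @ [b]) @ cs) = x" using xs dec by (cases as) auto
    moreover have "last ((as @ [b]) @ cs) = y" using xs dec by auto
    moreover have "length ((as @ [b]) @ cs) = Suc (length as + length cs)" by simp
    ultimately have "?P (length as + length cs)" by blast
    then have "gdist X x y \<le> length as + length cs" unfolding gdist_def by (rule Least_le)
    then show False using xs dec by simp
  qed
  then show ?thesis using that xs by blast
qed

text \<open>Some shortest walk is simple, and simple paths in a tree are unique. Hence distances can
  be read off from any simple path.\<close>

lemma gdist_simple_path:
  assumes "tree X" "walk X xs" "distinct xs"
  shows "gdist X (hd xs) (last xs) = length xs - 1"
proof -
  have "hd xs \<in> verts X" "last xs \<in> verts X"
    using assms(2) by (auto simp: walk_def intro: hd_in_set last_in_set)
  then obtain ys where ys: "walk X ys" "distinct ys" "hd ys = hd xs" "last ys = last xs"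
      "length ys = Suc (gdist X (hd xs) (last xs))"
    using shortest_walk assms(1) unfolding tree_def by metis
  have "xs = ys"
    using assms ys by (intro simple_path_unique[of X]) (auto simp: tree_def)
  then show ?thesis using ys by simp
qed

section \<open>A ray in a homogeneous tree\<close>

locale tree_with_ray =
  fixes Q :: nat and G :: "'a ugraph" and p :: "nat \<Rightarrow> 'a"
  assumes Q: "2 \<le> Q" and homogeneous: "homogeneous_tree Q G" and ray: "ray G p"
begin

lemma tree: "tree G" and connected: "connected_ugraph G" and acyclic: "\<nexists>c. cycle G c"
  and no_loops: "{x} \<notin> edges G"
  using homogeneous by (auto simp: homogeneous_tree_def tree_def)

lemma edge_verts: "{x, y} \<in> edges G \<Longrightarrow> x \<in> verts G \<and> y \<in> verts G"
  using tree by (force simp: tree_def wf_ugraph_def doubleton_eq_iff)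

lemma ray_verts [simp]: "p k \<in> verts G" and ray_inj: "p j = p k \<longleftrightarrow> j = k"
  and ray_edge: "{p k, p (Suc k)} \<in> edges G"
  using ray by (auto simp: ray_def inj_def)

definition nbrs :: "'a \<Rightarrow> 'a set" where
  "nbrs x = {y. {x, y} \<in> edges G}"

lemma card_nbrs: "x \<in> verts G \<Longrightarrow> card (nbrs x) = Q"
proof -
  assume x: "x \<in> verts G"
  have "bij_betw (\<lambda>y. {x, y}) (nbrs x) {e \<in> edges G. x \<in> e}"
  proof (rule bij_betwI')
    fix e assume e: "e \<in> {e \<in> edges G. x \<in> e}"
    then obtain u w where "e = {u, w}" using tree unfolding tree_def wf_ugraph_def by auto
    then show "\<exists>y\<in>nbrs x. e = {x, y}" using e by (auto simp: nbrs_def insert_commute)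
  qed (auto simp: nbrs_def doubleton_eq_iff)
  then have "card (nbrs x) = card {e \<in> edges G. x \<in> e}" by (rule bij_betw_same_card)
  then show ?thesis using homogeneous x by (simp add: homogeneous_tree_def)
qed

lemma finite_nbrs: "x \<in> verts G \<Longrightarrow> finite (nbrs x)"
  \<comment> \<open>An infinite set has \<open>card\<close> 0, which \<open>2 \<le> Q\<close> rules
    out.\<close>
  using card_nbrs Q by (metis card.infinite not_numeral_le_zero)

text \<open>The path from \<open>hd xs\<close> to the ray that stops at its first contact, the
  vertex \<open>p k\<close>. It is the witness from which depth and foot of \<open>hd xs\<close> are
  computed.\<close>

definition ray_path :: "'a list \<Rightarrow> nat \<Rightarrow> bool" where
  "ray_path xs k \<longleftrightarrow> walk G xs \<and> distinct xs \<and> last xs = p k \<and> set (butlast xs) \<inter> range p = {}"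

lemma walk_ray_segment: "j \<le> k \<Longrightarrow> walk G (map p [j..<Suc k])"
proof (induction k)
  case 0
  then show ?case by (simp add: walk_def)
next
  case (Suc k)
  show ?case
  proof (cases "j = Suc k")
    case True
    then show ?thesis by (simp add: walk_def)
  next
    case False
    then have "j \<le> k" using Suc by simp
    then have "walk G (map p [j..<Suc k] @ [p (Suc k)])"
      using Suc ray_edge[of k] by (subst walk_append) (auto simp: walk_def)
    then show ?thesis using \<open>j \<le> k\<close> by simp
  qed
qed

lemma walk_ray_segment_simps:
  assumes "j \<le> k"
  shows "walk G (map p [j..<Suc k])" "hd (map p [j..<Suc k]) = p j" "last (map p [j..<Suc k]) = p k"
  using walk_ray_segment[OF assms] assms
  by (auto simp: hd_map last_map simp del: upt_Suc)

text \<open>As \<open>xs\<close> touches the ray only in \<open>p k\<close>, walking along the ray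
  from there to \<open>p m\<close>, in either direction, repeats no vertex.\<close>

lemma ray_path_extend:
  assumes "ray_path xs k"
  obtains zs where "walk G (xs @ zs)" "distinct (xs @ zs)" "last (xs @ zs) = p m"
    "length zs = nat \<bar>int m - int k\<bar>"
proof -
  have xs: "walk G xs" "distinct xs" "last xs = p k" "set (butlast xs) \<inter> range p = {}"
    using assms by (auto simp: ray_path_def)
  have ne: "xs \<noteq> []" using xs(1) by (rule walk_ne)
  have sub: "set xs \<inter> range p \<subseteq> {p k}"
  proof -
    have "xs = butlast xs @ [p k]" using xs(3) ne by (metis append_butlast_last_id)
    then have "set xs = insert (p k) (set (butlast xs))"
      by (metis Un_insert_right empty_set list.simps(15) set_append sup_bot_right)
    then show ?thesis using xs(4) by auto
  qed
  consider "m = k" | "k < m" | "m < k" by linarith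
  then show ?thesis
  proof cases
    case 1
    then show ?thesis using that[of "[]"] xs by simp
  next
    case 2
    let ?zs = "map p [Suc k..<Suc m]"
    have "walk G (xs @ ?zs)"
      using 2 xs ne walk_ray_segment_simps[of "Suc k" m] ray_edge[of k]
      by (subst walk_append) (auto simp del: upt_Suc)
    moreover have "distinct (xs @ ?zs)"
      using sub xs(2) by (auto simp: distinct_map inj_on_def ray_inj simp del: upt_Suc)
    moreover have "last (xs @ ?zs) = p m" using 2 by simp
    moreover have "length ?zs = nat \<bar>int m - int k\<bar>" using 2 by simp
    ultimately show ?thesis using that by blast
  next
    case 3
    then obtain k' where k': "k = Suc k'" "m \<le> k'" by (cases k) auto
    let ?zs = "rev (map p [m..<k])"
    have "walk G (rev ?zs)" using k' walk_ray_segment_simps[of m k'] by (simp del: upt_Suc)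
    then have w: "walk G ?zs" by (simp only: walk_rev)
    have "walk G (xs @ ?zs)"
      using 3 xs ne w ray_edge[of k'] k'
      by (subst walk_append) (auto simp: insert_commute)
    moreover have "distinct (xs @ ?zs)"
      using sub xs(2) by (auto simp: distinct_map inj_on_def ray_inj simp del: upt_Suc)
    moreover have "last (xs @ ?zs) = p m" using 3 k' by (simp add: last_rev hd_map del: upt_Suc)
    moreover have "length ?zs = nat \<bar>int m - int k\<bar>" using 3 by simp
    ultimately show ?thesis using that by blast
  qed
qed

text \<open>The distance to \<open>p m\<close> is thus minimal exactly at \<open>m = k\<close>,
  which makes the infimum in \<open>dist_ray\<close> explicit and the description in
  \<open>foot\<close> well defined.\<close>

lemma ray_path_gdist:
  assumes "ray_path xs k"
  shows "gdist G (hd xs) (p m) = length xs - 1 + nat \<bar>int m - int k\<bar>"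
proof -
  obtain zs where zs: "walk G (xs @ zs)" "distinct (xs @ zs)" "last (xs @ zs) = p m"
    "length zs = nat \<bar>int m - int k\<bar>" using ray_path_extend[OF assms] by blast
  have "xs \<noteq> []" using assms by (auto simp: ray_path_def walk_def)
  then show ?thesis using gdist_simple_path[OF tree zs(1,2)] zs by (cases xs) auto
qed

text \<open>Prolonging \<open>xs\<close> along the ray to \<open>p k\<close> gives a simple path
  with the ends of \<open>ys\<close>, hence \<open>ys\<close> itself. Since \<open>ys\<close> meets
  the ray only at its end, nothing was appended.\<close>

lemma ray_path_unique:
  assumes "ray_path xs j" "ray_path ys k" "hd xs = hd ys"
  shows "xs = ys \<and> j = k"
proof -
  obtain zs where zs: "walk G (xs @ zs)" "distinct (xs @ zs)" "last (xs @ zs) = p k"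
    "length zs = nat \<bar>int k - int j\<bar>" using ray_path_extend[OF assms(1)] by blast
  have xs: "xs \<noteq> []" "last xs = p j" using assms(1) by (auto simp: ray_path_def walk_def)
  have eq: "xs @ zs = ys"
    using assms zs xs acyclic by (intro simple_path_unique[of G]) (auto simp: ray_path_def)
  have "zs = []"
  proof (rule ccontr)
    assume "zs \<noteq> []"
    then have "p j \<in> set (butlast ys)"
      using xs eq last_in_set[of xs] by (auto simp: butlast_append)
    then show False using assms(2) by (auto simp: ray_path_def)
  qed
  then show ?thesis using zs eq by simp
qed

text \<open>Cut a simple path from \<open>x\<close> to \<open>p 0\<close> at its first vertex on the
  ray.\<close>

lemma ray_path_exists:
  assumes "x \<in> verts G"
  obtains xs k where "ray_path xs k" "hd xs = x"
proof -
  obtain ws where ws: "walk G ws" "distinct ws" "hd ws = x" "last ws = p 0"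
    using shortest_walk[OF connected assms ray_verts[of 0]] by metis
  have "\<exists>z\<in>set ws. z \<in> range p" using ws walk_ne last_in_set by (metis rangeI)
  then obtain A z D where A: "ws = A @ z # D" "z \<in> range p" "\<forall>b\<in>set A. b \<notin> range p"
    by (elim split_list_first_propE)
  have "walk G ((A @ [z]) @ D)" using ws A by simp
  then have "walk G (A @ [z])" by (cases "D = []") (auto simp: walk_append simp del: append_assoc)
  then have "\<exists>k. ray_path (A @ [z]) k"
    using A ws by (auto simp: ray_path_def)
  moreover have "hd (A @ [z]) = x" using A ws by (cases A) auto
  ultimately show ?thesis using that by blast
qed

section \<open>Depth and foot of a vertex and of its neighbours\<close>

abbreviation depth :: "'a \<Rightarrow> nat" where "depth \<equiv> dist_ray G p"
abbreviation base :: "'a \<Rightarrow> nat" where "base \<equiv> foot G p"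

lemma depth_base:
  assumes "ray_path xs k"
  shows "depth (hd xs) = length xs - 1" "base (hd xs) = k"
proof -
  show d: "depth (hd xs) = length xs - 1"
    unfolding dist_ray_def
  proof (rule antisym)
    show "(INF j. gdist G (hd xs) (p j)) \<le> length xs - 1"
      by (rule cINF_lower2[of _ _ k]) (auto simp: ray_path_gdist[OF assms])
    show "length xs - 1 \<le> (INF j. gdist G (hd xs) (p j))"
      by (rule cINF_greatest) (auto simp: ray_path_gdist[OF assms])
  qed
  show "base (hd xs) = k"
    unfolding foot_def d ray_path_gdist[OF assms] by (rule the_equality) auto
qed

lemma ray_path_singleton: "ray_path [p k] k"
  by (simp add: ray_path_def walk_def)

lemma depth_ray [simp]: "depth (p k) = 0" and base_ray [simp]: "base (p k) = k"
  using depth_base[OF ray_path_singleton[of k]] by auto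

lemma depth_eq_0_iff:
  assumes "x \<in> verts G"
  shows "depth x = 0 \<longleftrightarrow> x = p (base x)"
proof
  assume 0: "depth x = 0"
  obtain xs k where xs: "ray_path xs k" "hd xs = x" using ray_path_exists[OF assms] .
  then have "length xs - 1 = 0" using depth_base 0 by metis
  moreover have "xs \<noteq> []" using xs by (auto simp: ray_path_def walk_def)
  ultimately have "xs = [x]" using xs(2) by (cases xs) auto
  then show "x = p (base x)" using xs depth_base[OF xs(1)] by (auto simp: ray_path_def)
next
  assume "x = p (base x)"
  then show "depth x = 0" by (metis depth_ray)
qed

lemma ray_path_tl: "ray_path (x # y # zs) k \<Longrightarrow> ray_path (y # zs) k"
  by (auto simp: ray_path_def walk_Cons)

lemma ray_path_Cons:
  assumes "ray_path xs k" "{y, hd xs} \<in> edges G" "y \<notin> set xs" "y \<notin> range p"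
  shows "ray_path (y # xs) k"
  using assms edge_verts[OF assms(2)] walk_ne[of G xs] by (auto simp: ray_path_def walk_Cons)

text \<open>An edge from \<open>x\<close> to a later vertex of its path would be a shortcut, giving
  a second path from \<open>x\<close> to the ray.\<close>

lemma ray_path_edge:
  assumes "ray_path (x # xs) k" "{x, y} \<in> edges G" "y \<in> set xs"
  shows "xs \<noteq> [] \<and> y = hd xs"
proof -
  obtain A D where A: "xs = A @ y # D" using split_list[OF assms(3)] by blast
  have w: "walk G (x # A @ y # D)" "distinct (x # A @ y # D)"
    and l: "last (x # A @ y # D) = p k" and b: "set (butlast (x # A @ y # D)) \<inter> range p = {}"
    using assms(1) A by (auto simp: ray_path_def)
  have "walk G ((x # A) @ y # D)" using w by simp
  then have "walk G (y # D)" by (subst (asm) walk_append) auto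
  then have "walk G (x # y # D)" using edge_verts[OF assms(2)] assms(2) by (simp add: walk_Cons)
  then have "ray_path (x # y # D) k"
    using w l b by (auto simp: ray_path_def butlast_append split: if_splits)
  then have "x # y # D = x # xs" using ray_path_unique[OF _ assms(1)] by auto
  then show ?thesis by auto
qed

text \<open>The neighbour \<open>z\<close> is the next vertex on the path from \<open>x\<close> to
  the ray. Putting any other neighbour in front of that path yields the path of this neighbour, one
  step longer than that of \<open>x\<close> and with the same foot.\<close>

lemma nbr_off_ray:
  assumes "x \<in> verts G" "depth x = Suc d"
  obtains z where "z \<in> nbrs x" "depth z = d" "base z = base x"
    "\<And>y. y \<in> nbrs x \<Longrightarrow> y \<noteq> z \<Longrightarrow> depth y = Suc (Suc d) \<and> base y = base x"
proof -
  obtain xs k where xs: "ray_path xs k" "hd xs = x" using ray_path_exists[OF assms(1)] .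
  have "length xs - 1 = Suc d" using depth_base[OF xs(1)] xs(2) assms(2) by simp
  then obtain z zs where xz: "xs = x # z # zs" and len: "length zs = d"
    using xs(2) by (cases xs; cases "tl xs") auto
  have rp: "ray_path (x # z # zs) k" using xs xz by simp
  have rz: "ray_path (z # zs) k" using ray_path_tl rp .
  show ?thesis
  proof (rule that)
    show "z \<in> nbrs x" using rp by (auto simp: nbrs_def ray_path_def walk_Cons)
    show "depth z = d" "base z = base x" using depth_base[OF rp] depth_base[OF rz] len by auto
    fix y assume y: "y \<in> nbrs x" "y \<noteq> z"
    then have e: "{x, y} \<in> edges G" by (simp add: nbrs_def)
    have "y \<notin> set (z # zs)" using ray_path_edge[OF rp e] y by auto
    moreover have "y \<noteq> x" using e no_loops by auto
    \<comment> \<open>If \<open>y\<close> were on the ray, \<open>[x, y]\<close> would be the path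
      from \<open>x\<close> to the ray, forcing \<open>y = z\<close>.\<close>
    moreover have "y \<notin> range p"
    proof
      assume "y \<in> range p"
      then obtain m where m: "y = p m" by auto
      have "ray_path [x, y] m"
        using e m edge_verts[OF e] rp \<open>y \<noteq> x\<close> by (auto simp: ray_path_def walk_Cons)
      then have "[x, y] = x # z # zs" using ray_path_unique[OF _ rp] by auto
      then show False using y by simp
    qed
    ultimately have "ray_path (y # x # z # zs) k"
      using e by (intro ray_path_Cons[OF rp]) (auto simp: insert_commute)
    from depth_base[OF this] show "depth y = Suc (Suc d) \<and> base y = base x"
      using depth_base[OF rp] len by auto
  qed
qed

lemma nbr_on_ray:
  "p m \<in> nbrs (p k) \<longleftrightarrow> m = Suc k \<or> k = Suc m"
proof
  assume "p m \<in> nbrs (p k)"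
  then have e: "{p k, p m} \<in> edges G" by (simp add: nbrs_def)
  then have ne: "m \<noteq> k" using no_loops[of "p k"] by auto
  have "walk G [p k, p m]" "distinct [p k, p m]"
    using e ne by (auto simp: walk_Cons ray_inj)
  then have "gdist G (p k) (p m) = 1" using gdist_simple_path[OF tree, of "[p k, p m]"] by simp
  then show "m = Suc k \<or> k = Suc m"
    using ray_path_gdist[OF ray_path_singleton[of k], of m] by (auto simp: nat_eq_iff)
next
  assume "m = Suc k \<or> k = Suc m"
  then show "p m \<in> nbrs (p k)" using ray_edge[of k] ray_edge[of m] by (auto simp: nbrs_def insert_commute)
qed

lemma nbr_of_ray:
  assumes "y \<in> nbrs (p k)" "y \<notin> range p"
  shows "depth y = 1 \<and> base y = k"
proof -
  have "ray_path [y, p k] k"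
    using assms by (intro ray_path_Cons ray_path_singleton) (auto simp: nbrs_def insert_commute)
  from depth_base[OF this] show ?thesis by auto
qed

text \<open>One neighbour lies a step nearer to the ray, the other \<open>Q - 1\<close> a step
  further away, all with the same foot.\<close>

lemma sum_nbrs_off_ray:
  fixes y :: "nat \<Rightarrow> real"
  assumes "x \<in> verts G" "depth x = Suc d"
  shows "(\<Sum>z\<in>nbrs x. a ^ depth z * y (base z)) =
    (a ^ d + (real Q - 1) * a ^ Suc (Suc d)) * y (base x)"
proof -
  obtain z where z: "z \<in> nbrs x" "depth z = d" "base z = base x"
    "\<And>w. w \<in> nbrs x \<Longrightarrow> w \<noteq> z \<Longrightarrow> depth w = Suc (Suc d) \<and> base w = base x"
    using nbr_off_ray[OF assms] by blast
  have fin: "finite (nbrs x)" using finite_nbrs assms by auto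
  have "(\<Sum>z\<in>nbrs x - {z}. a ^ depth z * y (base z)) =
      (\<Sum>w\<in>nbrs x - {z}. a ^ Suc (Suc d) * y (base x))"
    by (rule sum.cong) (use z in auto)
  also have "\<dots> = (real Q - 1) * a ^ Suc (Suc d) * y (base x)"
    using card_nbrs[OF assms(1)] z(1) fin Q by (simp add: of_nat_diff)
  finally show ?thesis
    using sum.remove[OF fin z(1), of "\<lambda>z. a ^ depth z * y (base z)"] z
    by (simp add: algebra_simps)
qed

text \<open>The set \<open>R\<close> collects the neighbours on the ray: one for the root, two for
  any other ray vertex. The remaining \<open>Q - 1\<close> or \<open>Q - 2\<close> neighbours have
  depth 1 and foot \<open>k\<close>.\<close>

lemma sum_nbrs_on_ray:
  fixes y :: "nat \<Rightarrow> real"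
  shows "(\<Sum>z\<in>nbrs (p k). a ^ depth z * y (base z)) =
    (if k = 0 then y 1 + (real Q - 1) * a * y 0
     else y (k - 1) + y (Suc k) + (real Q - 2) * a * y k)"
proof -
  have fin: "finite (nbrs (p k))" using finite_nbrs by auto
  define R where "R = p ` (if k = 0 then {1} else {k - 1, Suc k})"
  have "{m. m = Suc k \<or> k = Suc m} = (if k = 0 then {1} else {k - 1, Suc k})"
    by (cases k) auto
  then have "R = p ` {m. p m \<in> nbrs (p k)}"
    unfolding R_def nbr_on_ray by simp
  then have R: "R = nbrs (p k) \<inter> range p"
    by auto
  have cR: "card R = (if k = 0 then 1 else 2)"
    unfolding R_def by (auto simp: ray_inj)
  have sR: "(\<Sum>z\<in>R. a ^ depth z * y (base z)) = (if k = 0 then y 1 else y (k - 1) + y (Suc k))"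
    unfolding R_def by (auto simp: ray_inj)
  have "(\<Sum>z\<in>nbrs (p k) - R. a ^ depth z * y (base z)) = (\<Sum>z\<in>nbrs (p k) - R. a * y k)"
    by (rule sum.cong) (use nbr_of_ray[of _ k] R in auto)
  also have "\<dots> = (real Q - real (card R)) * (a * y k)"
  proof -
    have "card (nbrs (p k) - R) = Q - card R"
      using card_Diff_subset[of R "nbrs (p k)"] card_nbrs[of "p k"] R fin by auto
    then show ?thesis using Q cR by (auto simp: of_nat_diff)
  qed
  finally show ?thesis
    using sum.subset_diff[of R "nbrs (p k)" "\<lambda>z. a ^ depth z * y (base z)"] R fin sR cR
    by (auto simp: algebra_simps)
qed

end

section \<open>Symmetric nonnegative matrices with finite rows\<close>

lemma l2_norm_cmult: "l2_norm V (\<lambda>x. c * f x) = cmod c * l2_norm V f"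
  by (simp add: l2_norm_def norm_mult power_mult_distrib infsum_cmult_right' real_sqrt_mult)

lemma l2_cmult: "f \<in> l2 V \<Longrightarrow> (\<lambda>x. c * f x) \<in> l2 V"
  by (simp add: l2_def norm_mult power_mult_distrib summable_on_cmult_right)

lemma l2_norm_mono:
  assumes "f \<in> l2 V" "g \<in> l2 V" "\<And>x. x \<in> V \<Longrightarrow> cmod (f x) \<le> cmod (g x)"
  shows "l2_norm V f \<le> l2_norm V g"
  using assms unfolding l2_norm_def l2_def
  by (intro real_sqrt_le_mono infsum_mono power_mono) auto

lemma l2_norm_pos:
  assumes "f \<in> l2 V" "r \<in> V" "f r \<noteq> 0"
  shows "l2_norm V f > 0"
proof -
  have "0 < (cmod (f r))\<^sup>2" using assms by simp
  also have "\<dots> = sum (\<lambda>x. (cmod (f x))\<^sup>2) {r}" by simp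
  also have "\<dots> \<le> (\<Sum>\<^sub>\<infinity>x\<in>V. (cmod (f x))\<^sup>2)"
    using assms by (intro finite_sum_le_infsum) (auto simp: l2_def)
  finally show ?thesis by (simp add: l2_norm_def)
qed

lemma mat_apply_cmult: "mat_apply V B (\<lambda>x. c * f x) x = c * mat_apply V B f x"
proof -
  have "mat_apply V B (\<lambda>x. c * f x) x = (\<Sum>\<^sub>\<infinity>y\<in>V. c * (complex_of_real (B x y) * f y))"
    unfolding mat_apply_def by (simp add: mult_ac)
  then show ?thesis by (simp add: mat_apply_def infsum_cmult_right')
qed

lemma op_norm_bdd:
  assumes "l2_bounded V B"
  shows "bdd_above {l2_norm V (mat_apply V B f) | f. f \<in> l2 V \<and> l2_norm V f \<le> 1}"
proof -
  obtain C where C: "\<And>f. f \<in> l2 V \<Longrightarrow> l2_norm V (mat_apply V B f) \<le> C * l2_norm V f"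
    using assms by (auto simp: l2_bounded_def)
  have "l2_norm V (mat_apply V B f) \<le> \<bar>C\<bar>" if "f \<in> l2 V" "l2_norm V f \<le> 1" for f
  proof -
    have "0 \<le> l2_norm V f" by (auto simp: l2_norm_def intro: infsum_nonneg)
    then have "C * l2_norm V f \<le> \<bar>C\<bar> * 1" using that by (intro mult_mono) auto
    then show ?thesis using C[OF that(1)] by simp
  qed
  then show ?thesis by (intro bdd_aboveI[of _ "\<bar>C\<bar>"]) auto
qed

text \<open>Finite rows reduce the sums over \<open>V\<close> to finite sums over
  \<open>row x\<close>, so the matrix acts on arbitrary functions, in particular on generalized
  eigenvectors outside \<open>l2 V\<close>.\<close>

locale sym_matrix =
  fixes V :: "'a set" and B :: "'a \<Rightarrow> 'a \<Rightarrow> real"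
  assumes sym: "x \<in> V \<Longrightarrow> y \<in> V \<Longrightarrow> B x y = B y x"
    and nonneg: "x \<in> V \<Longrightarrow> y \<in> V \<Longrightarrow> 0 \<le> B x y"
    and finite_rows: "x \<in> V \<Longrightarrow> finite {y \<in> V. B x y \<noteq> 0}"
begin

definition row :: "'a \<Rightarrow> 'a set" where
  "row x = {y \<in> V. B x y \<noteq> 0}"

lemma row_subset: "y \<in> row x \<Longrightarrow> y \<in> V"
  by (simp add: row_def)

lemma finite_row: "x \<in> V \<Longrightarrow> finite (row x)"
  using finite_rows by (simp add: row_def)

lemma has_sum_row:
  fixes f :: "'a \<Rightarrow> 'b::real_normed_algebra_1"
  assumes "x \<in> V"
  shows "((\<lambda>y. of_real (B x y) * f y) has_sum (\<Sum>y\<in>row x. of_real (B x y) * f y)) V"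
  by (rule has_sum_finite_neutralI[of "row x"]) (use assms finite_row in \<open>auto simp: row_def\<close>)

lemma has_sum_row_real:
  fixes f :: "'a \<Rightarrow> real"
  assumes "x \<in> V"
  shows "((\<lambda>y. B x y * f y) has_sum (\<Sum>y\<in>row x. B x y * f y)) V"
  using has_sum_row[OF assms, of f] by simp

section \<open>Upper bound for the norm by a positive weight\<close>

lemma mat_apply_row:
  "x \<in> V \<Longrightarrow> mat_apply V B f x = (\<Sum>y\<in>row x. complex_of_real (B x y) * f y)"
  unfolding mat_apply_def by (rule infsumI[OF has_sum_row])

text \<open>Split each term \<open>B x y * |f y|\<close> as \<open>sqrt (B x y * v y)\<close> times
  \<open>sqrt (B x y * g y)\<close> with \<open>g = |f|^2 / v\<close>. Cauchy-Schwarz and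
  \<open>super\<close> give one factor \<open>l\<close>; after exchanging the sums, symmetry allows
  \<open>super\<close> to be used on columns for the second. Finite \<open>F\<close> avoids
  presupposing that the image is square summable.\<close>

lemma schur_test_sum:
  assumes v: "\<And>x. x \<in> V \<Longrightarrow> 0 < v x"
    and super: "\<And>x. x \<in> V \<Longrightarrow> (\<Sum>y\<in>row x. B x y * v y) \<le> l * v x"
    and l: "0 \<le> l" and f: "f \<in> l2 V" and F: "finite F" "F \<subseteq> V"
  shows "(\<Sum>x\<in>F. (cmod (mat_apply V B f x))\<^sup>2) \<le> l\<^sup>2 * (\<Sum>\<^sub>\<infinity>x\<in>V. (cmod (f x))\<^sup>2)"
proof -
  define g where "g y = (cmod (f y))\<^sup>2 / v y" for y
  \<comment> \<open>All columns met by rows in \<open>F\<close>; being finite, \<open>S\<close>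
    makes the exchange of sums below elementary.\<close>
  define S where "S = (\<Union>x\<in>F. row x)"
  have S: "finite S" "S \<subseteq> V" using F finite_row row_subset by (auto simp: S_def)
  have v0: "0 \<le> v y" if "y \<in> V" for y using v[OF that] by simp
  have g: "0 \<le> g y" if "y \<in> V" for y using v[OF that] by (simp add: g_def)
  have step1: "(cmod (mat_apply V B f x))\<^sup>2 \<le> l * v x * (\<Sum>y\<in>S. B x y * g y)" if x: "x \<in> F" for x
  proof -
    have xV: "x \<in> V" using x F by auto
    have "cmod (mat_apply V B f x) \<le> (\<Sum>y\<in>row x. cmod (complex_of_real (B x y) * f y))"
      unfolding mat_apply_row[OF xV] by (rule norm_sum)
    also have "\<dots> = (\<Sum>y\<in>row x. sqrt (B x y * v y) * sqrt (B x y * g y))"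
    proof (rule sum.cong)
      fix y assume y: "y \<in> row x"
      then have *: "0 < v y" "0 \<le> B x y" using v nonneg row_subset xV by auto
      have "sqrt (B x y * v y) * sqrt (B x y * g y) = sqrt ((B x y)\<^sup>2 * (cmod (f y))\<^sup>2)"
        using * by (simp add: real_sqrt_mult[symmetric] g_def power2_eq_square)
      also have "\<dots> = B x y * cmod (f y)" using * by (simp add: real_sqrt_mult)
      finally show "cmod (complex_of_real (B x y) * f y) = sqrt (B x y * v y) * sqrt (B x y * g y)"
        using * by (simp add: norm_mult)
    qed simp
    finally have "(cmod (mat_apply V B f x))\<^sup>2
        \<le> (\<Sum>y\<in>row x. sqrt (B x y * v y) * sqrt (B x y * g y))\<^sup>2"
      by (rule power_mono) simp
    also have "\<dots> \<le> (\<Sum>y\<in>row x. (sqrt (B x y * v y))\<^sup>2) * (\<Sum>y\<in>row x. (sqrt (B x y * g y))\<^sup>2)"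
      by (rule Cauchy_Schwarz_ineq_sum)
    also have "\<dots> = (\<Sum>y\<in>row x. B x y * v y) * (\<Sum>y\<in>row x. B x y * g y)"
      using xV nonneg row_subset v0 g
      by (intro arg_cong2[where f="(*)"] sum.cong refl real_sqrt_pow2 mult_nonneg_nonneg) auto
    also have "(\<Sum>y\<in>row x. B x y * g y) = (\<Sum>y\<in>S. B x y * g y)"
      by (rule sum.mono_neutral_left) (use x S in \<open>auto simp: S_def row_def\<close>)
    also have "(\<Sum>y\<in>row x. B x y * v y) * (\<Sum>y\<in>S. B x y * g y) \<le> l * v x * (\<Sum>y\<in>S. B x y * g y)"
      by (rule mult_right_mono[OF super[OF xV]])
        (use S xV nonneg g in \<open>auto intro!: sum_nonneg mult_nonneg_nonneg\<close>)
    finally show ?thesis .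
  qed
  have step2: "(\<Sum>x\<in>F. B x y * v x) \<le> l * v y" if y: "y \<in> V" for y
  proof -
    have "(\<Sum>x\<in>F. B x y * v x) = (\<Sum>x\<in>F. B y x * v x)"
      using F y sym by (intro sum.cong) auto
    also have "\<dots> = (\<Sum>x\<in>F \<inter> row y. B y x * v x)"
      by (rule sum.mono_neutral_right) (use F y in \<open>auto simp: row_def\<close>)
    also have "\<dots> \<le> (\<Sum>x\<in>row y. B y x * v x)"
      using finite_row[OF y] nonneg[OF y] v0 row_subset
      by (intro sum_mono2) auto
    also have "\<dots> \<le> l * v y" by (rule super[OF y])
    finally show ?thesis .
  qed
  have "(\<Sum>x\<in>F. (cmod (mat_apply V B f x))\<^sup>2) \<le> (\<Sum>x\<in>F. l * v x * (\<Sum>y\<in>S. B x y * g y))"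
    by (rule sum_mono) (rule step1)
  also have "\<dots> = (\<Sum>x\<in>F. \<Sum>y\<in>S. l * g y * (B x y * v x))"
    by (simp add: sum_distrib_left mult_ac)
  also have "\<dots> = (\<Sum>y\<in>S. \<Sum>x\<in>F. l * g y * (B x y * v x))" by (rule sum.swap)
  also have "\<dots> = (\<Sum>y\<in>S. l * g y * (\<Sum>x\<in>F. B x y * v x))"
    by (simp add: sum_distrib_left)
  also have "\<dots> \<le> (\<Sum>y\<in>S. l * g y * (l * v y))"
    using S l g by (intro sum_mono mult_left_mono step2) auto
  also have "\<dots> = (\<Sum>y\<in>S. l\<^sup>2 * (cmod (f y))\<^sup>2)"
  proof (rule sum.cong)
    fix y assume "y \<in> S"
    then have "0 < v y" using S v by auto
    then show "l * g y * (l * v y) = l\<^sup>2 * (cmod (f y))\<^sup>2" by (simp add: g_def power2_eq_square)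
  qed simp
  also have "\<dots> = l\<^sup>2 * (\<Sum>y\<in>S. (cmod (f y))\<^sup>2)" by (simp add: sum_distrib_left)
  also have "\<dots> \<le> l\<^sup>2 * (\<Sum>\<^sub>\<infinity>x\<in>V. (cmod (f x))\<^sup>2)"
    using f S by (intro mult_left_mono finite_sum_le_infsum) (auto simp: l2_def)
  finally show ?thesis .
qed

context
  fixes v :: "'a \<Rightarrow> real" and l :: real
  assumes v: "\<And>x. x \<in> V \<Longrightarrow> 0 < v x"
    and super: "\<And>x. x \<in> V \<Longrightarrow> (\<Sum>y\<in>row x. B x y * v y) \<le> l * v x"
    and l: "0 \<le> l"
begin

lemma schur_test_l2:
  assumes "f \<in> l2 V"
  shows "mat_apply V B f \<in> l2 V"
proof -
  have "(\<lambda>x. (cmod (mat_apply V B f x))\<^sup>2) summable_on V"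
    by (rule nonneg_bounded_partial_sums_imp_summable_on[where C="l\<^sup>2 * (\<Sum>\<^sub>\<infinity>x\<in>V. (cmod (f x))\<^sup>2)"])
      (auto intro!: eventually_finite_subsets_at_top_weakI schur_test_sum[OF v super l assms])
  then show ?thesis by (simp add: l2_def)
qed

lemma schur_test_norm:
  assumes "f \<in> l2 V"
  shows "l2_norm V (mat_apply V B f) \<le> l * l2_norm V f"
proof -
  have "(\<Sum>\<^sub>\<infinity>x\<in>V. (cmod (mat_apply V B f x))\<^sup>2) \<le> l\<^sup>2 * (\<Sum>\<^sub>\<infinity>x\<in>V. (cmod (f x))\<^sup>2)"
    using schur_test_l2[OF assms]
    by (intro infsum_le_finite_sums schur_test_sum[OF v super l assms]) (auto simp: l2_def)
  then have "l2_norm V (mat_apply V B f) \<le> sqrt (l\<^sup>2 * (\<Sum>\<^sub>\<infinity>x\<in>V. (cmod (f x))\<^sup>2))"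
    unfolding l2_norm_def by (rule real_sqrt_le_mono)
  then show ?thesis using l by (simp add: l2_norm_def real_sqrt_mult)
qed

lemma schur_test: "l2_bounded V B" "op_norm V B \<le> l"
proof -
  show "l2_bounded V B"
    unfolding l2_bounded_def
    using schur_test_l2 schur_test_norm has_sum_row by (blast intro: has_sum_imp_summable)
  have z: "(\<lambda>_. 0) \<in> l2 V" "l2_norm V (\<lambda>_. 0) \<le> 1" by (auto simp: l2_def l2_norm_def)
  show "op_norm V B \<le> l"
    unfolding op_norm_def
  proof (rule cSup_least)
    show "{l2_norm V (mat_apply V B f) | f. f \<in> l2 V \<and> l2_norm V f \<le> 1} \<noteq> {}" using z by blast
    fix t assume "t \<in> {l2_norm V (mat_apply V B f) | f. f \<in> l2 V \<and> l2_norm V f \<le> 1}"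
    then obtain f where f: "f \<in> l2 V" "l2_norm V f \<le> 1" "t = l2_norm V (mat_apply V B f)" by auto
    have "t \<le> l * l2_norm V f" using schur_test_norm f by simp
    also have "\<dots> \<le> l" using f l by (simp add: mult_left_le)
    finally show "t \<le> l" .
  qed
qed

end

text \<open>Test the supremum on the normalized \<open>u\<close>: a pointwise inequality between
  nonnegative functions passes to norms. The inequality form of \<open>sub\<close> lets an
  eigenvector for one loop set serve as test function for a larger one.\<close>

lemma op_norm_lower:
  assumes bdd: "l2_bounded V B" and u: "\<And>x. x \<in> V \<Longrightarrow> 0 \<le> u x"
    and u_l2: "(\<lambda>x. complex_of_real (u x)) \<in> l2 V" and r: "r \<in> V" "u r \<noteq> 0"
    and sub: "\<And>x. x \<in> V \<Longrightarrow> m * u x \<le> (\<Sum>y\<in>row x. B x y * u y)" and m: "0 \<le> m"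
  shows "m \<le> op_norm V B"
proof -
  let ?u = "\<lambda>x. complex_of_real (u x)"
  define N where "N = l2_norm V ?u"
  have N: "0 < N" unfolding N_def using u_l2 r by (intro l2_norm_pos[of _ _ r]) auto
  define f where "f = (\<lambda>x. complex_of_real (1 / N) * ?u x)"
  have f: "f \<in> l2 V" unfolding f_def by (rule l2_cmult[OF u_l2])
  have "l2_norm V f = 1"
    unfolding f_def l2_norm_cmult using N by (simp add: N_def norm_divide)
  have Bu: "mat_apply V B ?u \<in> l2 V" using bdd u_l2 by (auto simp: l2_bounded_def)
  have "l2_norm V (\<lambda>x. complex_of_real m * ?u x) \<le> l2_norm V (mat_apply V B ?u)"
  proof (rule l2_norm_mono[OF l2_cmult[OF u_l2] Bu])
    fix x assume x: "x \<in> V"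
    have "mat_apply V B ?u x = complex_of_real (\<Sum>y\<in>row x. B x y * u y)"
      by (simp add: mat_apply_row[OF x])
    moreover have "cmod (complex_of_real m * ?u x) = m * u x"
      using m u[OF x] by (simp add: norm_mult)
    moreover have "0 \<le> m * u x" using m u[OF x] by simp
    ultimately show "cmod (complex_of_real m * ?u x) \<le> cmod (mat_apply V B ?u x)"
      using sub[OF x] by (simp only: norm_of_real)
  qed
  then have "m * N \<le> l2_norm V (mat_apply V B ?u)"
    unfolding l2_norm_cmult using m by (simp add: N_def)
  moreover have "l2_norm V (mat_apply V B f) = l2_norm V (mat_apply V B ?u) / N"
  proof -
    have "mat_apply V B f = (\<lambda>x. complex_of_real (1 / N) * mat_apply V B ?u x)"
      unfolding f_def by (rule ext) (rule mat_apply_cmult)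
    then show ?thesis using N by (simp only: l2_norm_cmult) (simp add: norm_divide)
  qed
  ultimately have "m \<le> l2_norm V (mat_apply V B f)" using N by (simp add: pos_le_divide_eq)
  also have "\<dots> \<le> op_norm V B"
    unfolding op_norm_def using f \<open>l2_norm V f = 1\<close>
    by (intro cSup_upper op_norm_bdd bdd) auto
  finally show ?thesis .
qed

section \<open>Uniqueness of positive eigenvectors\<close>

text \<open>
  The minimum \<open>u\<close> of two positive \<open>l\<close>-eigenvectors is superharmonic, and pairing its defect
  with \<open>v\<close> gives zero by symmetry, so \<open>u\<close> is again an eigenvector.
\<close>

lemma min_eigenvector:
  assumes v: "\<And>x. x \<in> V \<Longrightarrow> 0 < v x" and w: "\<And>x. x \<in> V \<Longrightarrow> 0 < w x"
    and v_l2: "(\<lambda>x. complex_of_real (v x)) \<in> l2 V"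
    and Bv: "\<And>x. x \<in> V \<Longrightarrow> (\<Sum>y\<in>row x. B x y * v y) = l * v x"
    and Bw: "\<And>x. x \<in> V \<Longrightarrow> (\<Sum>y\<in>row x. B x y * w y) = l * w x"
    and x: "x \<in> V"
  shows "(\<Sum>y\<in>row x. B x y * min (v y) (w y)) = l * min (v x) (w x)"
proof -
  define u where "u x = min (v x) (w x)" for x
  define Bu where "Bu x = (\<Sum>y\<in>row x. B x y * u y)" for x
  have u: "0 < u x" "u x \<le> v x" "u x \<le> w x" if "x \<in> V" for x
    using v w that by (auto simp: u_def)
  have u0: "0 \<le> u x" and v0: "0 \<le> v x" if "x \<in> V" for x
    using u[OF that] v[OF that] by auto
  have Bu_le: "Bu x \<le> l * u x" if x: "x \<in> V" for x
  proof -
    have "Bu x \<le> (\<Sum>y\<in>row x. B x y * v y)" "Bu x \<le> (\<Sum>y\<in>row x. B x y * w y)"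
      unfolding Bu_def using x nonneg row_subset u
      by (auto intro!: sum_mono mult_left_mono)
    then show ?thesis using Bv[OF x] Bw[OF x] by (auto simp: u_def min_def)
  qed
  have Bu_nonneg: "0 \<le> Bu x" if x: "x \<in> V" for x
    unfolding Bu_def using x nonneg row_subset u0
    by (auto intro!: sum_nonneg)
  have "(\<lambda>x. (v x)\<^sup>2) summable_on V" using v_l2 by (simp add: l2_def)
  \<comment> \<open>Only \<open>v\<close> is known to be square summable; \<open>u \<le> v\<close>
    dominates \<open>v * u\<close> by the square of \<open>v\<close>.\<close>
  then have uv: "(\<lambda>x. v x * u x) summable_on V"
    by (rule summable_on_comparison_test)
      (use u u0 v0 in \<open>auto simp: power2_eq_square intro!: mult_left_mono\<close>)
  then have luv: "(\<lambda>x. l * (v x * u x)) summable_on V" by (rule summable_on_cmult_right)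
  have vBu: "(\<lambda>x. v x * Bu x) summable_on V"
  proof (rule summable_on_comparison_test[OF luv])
    fix x assume x: "x \<in> V"
    show "v x * Bu x \<le> l * (v x * u x)"
      using mult_left_mono[OF Bu_le[OF x], of "v x"] v[OF x] by (simp add: mult_ac)
    show "0 \<le> v x * Bu x" using Bu_nonneg[OF x] v[OF x] by simp
  qed
  have row_sum: "((\<lambda>y. v x * B x y * u y) has_sum v x * Bu x) V" if "x \<in> V" for x
    using has_sum_cmult_right[OF has_sum_row_real[OF that, of u], of "v x"]
    by (simp add: Bu_def mult_ac)
  have col_sum: "((\<lambda>x. v x * B x y * u y) has_sum l * (v y * u y)) V" if y: "y \<in> V" for y
  proof -
    have "((\<lambda>x. u y * (B y x * v x)) has_sum u y * (l * v y)) V"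
      using has_sum_row_real[OF y, of v] Bv[OF y] by (intro has_sum_cmult_right) simp
    then show ?thesis
      by (subst has_sum_cong[where g = "\<lambda>x. u y * (B y x * v x)"])
        (use sym y in \<open>auto simp: mult_ac\<close>)
  qed
  \<comment> \<open>Summability of the nonnegative double family permits the exchange of sums, which
    expresses that pairing \<open>v\<close> with \<open>Bu\<close> equals pairing the image of
    \<open>v\<close> with \<open>u\<close>.\<close>
  have sum2: "(\<lambda>(x, y). v x * B x y * u y) summable_on V \<times> V"
    by (rule summable_on_SigmaI[where g = "\<lambda>x. v x * Bu x"])
      (use row_sum vBu v0 u0 nonneg in auto)
  have "(\<Sum>\<^sub>\<infinity>x\<in>V. v x * Bu x) = (\<Sum>\<^sub>\<infinity>x\<in>V. \<Sum>\<^sub>\<infinity>y\<in>V. v x * B x y * u y)"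
    using infsumI[OF row_sum] by (intro infsum_cong) simp
  also have "\<dots> = (\<Sum>\<^sub>\<infinity>y\<in>V. \<Sum>\<^sub>\<infinity>x\<in>V. v x * B x y * u y)"
    by (rule infsum_swap_banach[OF sum2])
  also have "\<dots> = (\<Sum>\<^sub>\<infinity>y\<in>V. l * (v y * u y))"
    using infsumI[OF col_sum] by (intro infsum_cong) simp
  finally have eq: "(\<Sum>\<^sub>\<infinity>x\<in>V. v x * Bu x) = (\<Sum>\<^sub>\<infinity>y\<in>V. l * (v y * u y))" .
  have "((\<lambda>x. l * (v x * u x) + - 1 * (v x * Bu x)) has_sum
      (\<Sum>\<^sub>\<infinity>y\<in>V. l * (v y * u y)) + - 1 * (\<Sum>\<^sub>\<infinity>x\<in>V. v x * Bu x)) V"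
    using luv vBu by (intro has_sum_add has_sum_cmult_right has_sum_infsum)
  then have "((\<lambda>x. v x * (l * u x - Bu x)) has_sum 0) V"
    using eq by (simp add: algebra_simps)
  then have "v x * (l * u x - Bu x) = 0"
    by (rule nonneg_has_sum_le_0D) (use Bu_le v0 x in auto)
  then show ?thesis using v[OF x] by (simp add: Bu_def u_def)
qed

text \<open>The function \<open>z = v - min v w\<close> is a nonnegative solution of the eigenvalue
  equation with \<open>z r = 0\<close>. Where such a function vanishes, it vanishes on the whole
  row, so irreducibility spreads the zero from \<open>r\<close> over \<open>V\<close>.\<close>

lemma eigenvector_le:
  assumes v: "\<And>x. x \<in> V \<Longrightarrow> 0 < v x" and w: "\<And>x. x \<in> V \<Longrightarrow> 0 < w x"
    and v_l2: "(\<lambda>x. complex_of_real (v x)) \<in> l2 V"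
    and Bv: "\<And>x. x \<in> V \<Longrightarrow> (\<Sum>y\<in>row x. B x y * v y) = l * v x"
    and Bw: "\<And>x. x \<in> V \<Longrightarrow> (\<Sum>y\<in>row x. B x y * w y) = l * w x"
    and irreducible: "\<And>S. r \<in> S \<Longrightarrow> (\<And>x y. x \<in> S \<Longrightarrow> y \<in> row x \<Longrightarrow> y \<in> S) \<Longrightarrow> V \<subseteq> S"
    and r: "r \<in> V" "v r = w r" and x: "x \<in> V"
  shows "v x \<le> w x"
proof -
  define z where "z x = v x - min (v x) (w x)" for x
  have Bz: "(\<Sum>y\<in>row x. B x y * z y) = l * z x" if "x \<in> V" for x
    using Bv[OF that] min_eigenvector[OF v w v_l2 Bv Bw that]
    by (simp add: z_def right_diff_distrib sum_subtractf)
  have z0: "0 \<le> z x" for x by (simp add: z_def)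
  have "V \<subseteq> {x \<in> V. z x = 0}"
  proof (rule irreducible)
    show "r \<in> {x \<in> V. z x = 0}" using r by (simp add: z_def)
    fix x y assume "x \<in> {x \<in> V. z x = 0}" and y: "y \<in> row x"
    then have x: "x \<in> V" "(\<Sum>y\<in>row x. B x y * z y) = 0" using Bz by auto
    have "\<And>y. y \<in> row x \<Longrightarrow> 0 \<le> B x y * z y" using nonneg row_subset x z0 by auto
    then have "B x y * z y = 0"
      using x y finite_row[OF x(1)] by (simp add: sum_nonneg_eq_0_iff)
    then show "y \<in> {x \<in> V. z x = 0}" using y by (auto simp: row_def)
  qed
  then have "z x = 0" using x by auto
  then show ?thesis by (simp add: z_def min_def split: if_splits)
qed

end

section \<open>The adjacency operator of a tree with loops on the ray\<close>

context tree_with_ray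
begin

lemma adjacency_loops: "adjacency (add_loops G S) x y =
    (if {x, y} \<in> edges G \<or> x = y \<and> x \<in> S then 1 else 0)"
proof -
  have "{e \<in> edges (add_loops G S). e = {x, y}} =
      (if {x, y} \<in> edges G \<or> x = y \<and> x \<in> S then {{x, y}} else {})"
    by (auto simp: add_loops_def doubleton_eq_iff)
  then show ?thesis unfolding adjacency_def by (simp only: if_distrib) simp
qed

lemma verts_add_loops [simp]: "verts (add_loops G S) = verts G"
  by (simp add: add_loops_def)

text \<open>The loop set stays a parameter, so that \<open>graph_Y\<close> and
  \<open>graph_H\<close> are instances of one theory and can be compared.\<close>

sublocale L: sym_matrix "verts G" "adjacency (add_loops G S)" for S
proof
  fix x y
  show "adjacency (add_loops G S) x y = adjacency (add_loops G S) y x"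
    by (auto simp: adjacency_loops insert_commute)
  show "0 \<le> adjacency (add_loops G S) x y"
    by (simp add: adjacency_loops)
  assume "x \<in> verts G"
  then have "finite (insert x (nbrs x))" using finite_nbrs by simp
  then show "finite {y \<in> verts G. adjacency (add_loops G S) x y \<noteq> 0}"
    by (rule rev_finite_subset) (auto simp: adjacency_loops nbrs_def)
qed

lemma row_loops: "x \<in> verts G \<Longrightarrow> L.row S x = nbrs x \<union> (if x \<in> S then {x} else {})"
  using edge_verts by (auto simp: L.row_def adjacency_loops nbrs_def)

lemma sum_row_loops:
  assumes "x \<in> verts G"
  shows "(\<Sum>y\<in>L.row S x. adjacency (add_loops G S) x y * f y) =
    (\<Sum>y\<in>nbrs x. f y) + (if x \<in> S then f x else 0)"
proof -
  have "(\<Sum>y\<in>L.row S x. adjacency (add_loops G S) x y * f y) = (\<Sum>y\<in>L.row S x. f y)"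
    by (rule sum.cong) (auto simp: row_loops[OF assms] adjacency_loops nbrs_def split: if_splits)
  also have "\<dots> = (\<Sum>y\<in>nbrs x. f y) + (if x \<in> S then f x else 0)"
    using finite_nbrs[OF assms] no_loops[of x]
    by (auto simp: row_loops[OF assms] nbrs_def)
  finally show ?thesis .
qed

lemma connected_closed:
  assumes r: "r \<in> verts G" "r \<in> S" and closed: "\<And>x y. x \<in> S \<Longrightarrow> y \<in> nbrs x \<Longrightarrow> y \<in> S"
  shows "verts G \<subseteq> S"
proof
  fix x assume "x \<in> verts G"
  then obtain ws where ws: "walk G ws" "hd ws = r" "last ws = x"
    using connected r by (auto simp: connected_ugraph_def)
  have "last ws \<in> S" if "walk G ws" "hd ws \<in> S" for ws
    using that
  proof (induction ws)
    case Nil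
    then show ?case by (simp add: walk_def)
  next
    case (Cons w ws)
    then show ?case using closed by (cases "ws = []") (auto simp: walk_Cons nbrs_def)
  qed
  then show "x \<in> S" using ws r by auto
qed

text \<open>Both vectors belong to the same eigenvalue, the operator norm, and both are square
  summable; hence \<open>eigenvector_le\<close> applies in both directions. Connectedness supplies
  its irreducibility hypothesis.\<close>

lemma normalized_l2_PF_unique:
  assumes v: "normalized_l2_PF (add_loops G S) (p 0) v"
    and w: "normalized_l2_PF (add_loops G S) (p 0) w" and x: "x \<in> verts G"
  shows "v x = w x"
proof -
  define l where "l = op_norm (verts G) (adjacency (add_loops G S))"
  have *: "(\<forall>x\<in>verts G. 0 < u x) \<and> (\<lambda>x. complex_of_real (u x)) \<in> l2 (verts G) \<and> u (p 0) = 1 \<and>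
      (\<forall>x\<in>verts G. (\<Sum>y\<in>L.row S x. adjacency (add_loops G S) x y * u y) = l * u x)"
    if "normalized_l2_PF (add_loops G S) (p 0) u" for u
    using that has_sum_unique[OF L.has_sum_row_real[of _ S u]]
    by (auto simp: normalized_l2_PF_def PF_eigenvector_def l_def)
  have irr: "verts G \<subseteq> T" if "p 0 \<in> T" "\<And>x y. x \<in> T \<Longrightarrow> y \<in> L.row S x \<Longrightarrow> y \<in> T" for T
  proof -
    have "verts G \<subseteq> T \<inter> verts G"
      by (rule connected_closed[of "p 0"])
        (use that edge_verts in \<open>auto simp: row_loops nbrs_def\<close>)
    then show ?thesis by auto
  qed
  show ?thesis
    using L.eigenvector_le[of v w S l "p 0" x] L.eigenvector_le[of w v S l "p 0" x]
      *[OF v] *[OF w] irr x by (auto intro: antisym)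
qed

subsection \<open>Weights depending on the distance to the ray and the foot\<close>

definition profile :: "real \<Rightarrow> (nat \<Rightarrow> real) \<Rightarrow> 'a \<Rightarrow> real" where
  "profile a y x = a ^ depth x * y (base x)"

lemma profile_ray [simp]: "profile a y (p k) = y k"
  by (simp add: profile_def)

text \<open>Off the ray the equation reduces to the relation \<open>l\<close> between
  \<open>a\<close> and the eigenvalue, whatever \<open>y\<close> is. The root has one more neighbour
  off the ray than the other ray vertices, whence the separate condition \<open>y0\<close>.\<close>

lemma profile_eigenvector:
  fixes y :: "nat \<Rightarrow> real"
  assumes a: "a \<noteq> 0" and l: "l = 1 / a + (real Q - 1) * a"
    and y0: "y 1 + (real Q - 1) * a * y 0 + (if 0 \<in> K then y 0 else 0) = l * y 0"
    and ySuc: "\<And>k. y k + y (Suc (Suc k)) + (real Q - 2) * a * y (Suc k)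
      + (if Suc k \<in> K then y (Suc k) else 0) = l * y (Suc k)"
    and x: "x \<in> verts G"
  shows "(\<Sum>z\<in>L.row (p ` K) x. adjacency (add_loops G (p ` K)) x z * profile a y z)
    = l * profile a y x"
proof (cases "depth x")
  case 0
  then obtain k where k: "x = p k" using depth_eq_0_iff[OF x] by blast
  have K: "p k \<in> p ` K \<longleftrightarrow> k \<in> K" by (auto simp: ray_inj)
  show ?thesis
    unfolding sum_row_loops[OF x] unfolding k K profile_ray
    unfolding profile_def sum_nbrs_on_ray
    using y0 ySuc[of "k - 1"] by (cases k) auto
next
  case (Suc d)
  then have "x \<notin> p ` K" by (metis depth_ray imageE nat.distinct(1))
  moreover have "a ^ d + (real Q - 1) * a ^ Suc (Suc d) = l * a ^ Suc d"
    using a by (simp add: l field_simps)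
  ultimately show ?thesis
    unfolding sum_row_loops[OF x] unfolding profile_def sum_nbrs_off_ray[OF x Suc]
    by (simp add: Suc)
qed

section \<open>Square summability of profiles\<close>

definition cell :: "nat \<Rightarrow> nat \<Rightarrow> 'a set" where
  "cell k d = {x \<in> verts G. base x = k \<and> depth x = d}"

text \<open>Every vertex of depth \<open>d + 1\<close> has a neighbour of depth \<open>d\<close>
  with the same foot. Conversely each vertex of \<open>cell k d\<close> has a neighbour outside the
  next cell, along the ray if \<open>d = 0\<close> and towards it otherwise, which leaves at most
  \<open>Q - 1\<close>.\<close>

lemma card_cell: "finite (cell k d) \<and> card (cell k d) \<le> (Q - 1) ^ d"
proof (induction d)
  case 0
  have "cell k 0 \<subseteq> {p k}" using depth_eq_0_iff by (auto simp: cell_def)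
  then show ?case using finite_subset card_mono[of "{p k}" "cell k 0"] by auto
next
  case (Suc d)
  have sub: "cell k (Suc d) \<subseteq> (\<Union>x\<in>cell k d. nbrs x \<inter> cell k (Suc d))"
  proof
    fix y assume y: "y \<in> cell k (Suc d)"
    then obtain z where z: "z \<in> nbrs y" "depth z = d" "base z = base y"
      using nbr_off_ray[of y d] by (auto simp: cell_def)
    then have "z \<in> cell k d" "y \<in> nbrs z"
      using y edge_verts by (auto simp: nbrs_def insert_commute cell_def)
    then show "y \<in> (\<Union>x\<in>cell k d. nbrs x \<inter> cell k (Suc d))" using y by auto
  qed
  have card_x: "card (nbrs x \<inter> cell k (Suc d)) \<le> Q - 1" if x: "x \<in> cell k d" for x
  proof -
    have xV: "x \<in> verts G" and xk: "base x = k" "depth x = d" using x by (auto simp: cell_def)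
    have "\<exists>z\<in>nbrs x. z \<notin> cell k (Suc d)"
    proof (cases d)
      case 0
      then have "x = p k" using depth_eq_0_iff[OF xV] xk by simp
      moreover have "p (Suc k) \<notin> cell k (Suc d)" by (simp add: cell_def)
      ultimately show ?thesis using nbr_on_ray[of "Suc k" k] by auto
    next
      case (Suc e)
      then obtain z where z: "z \<in> nbrs x" "depth z = e"
        using nbr_off_ray[OF xV] xk by metis
      then show ?thesis using Suc by (intro bexI[of _ z]) (auto simp: cell_def)
    qed
    then obtain z where z: "z \<in> nbrs x" "z \<notin> cell k (Suc d)" by auto
    have "card (nbrs x \<inter> cell k (Suc d)) \<le> card (nbrs x - {z})"
      using finite_nbrs[OF xV] z by (intro card_mono) auto
    then show ?thesis using z finite_nbrs[OF xV] card_nbrs[OF xV] by simp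
  qed
  have fin: "finite (\<Union>x\<in>cell k d. nbrs x \<inter> cell k (Suc d))"
    using Suc finite_nbrs by (auto simp: cell_def)
  have "card (cell k (Suc d)) \<le> card (\<Union>x\<in>cell k d. nbrs x \<inter> cell k (Suc d))"
    by (rule card_mono[OF fin sub])
  also have "\<dots> \<le> (\<Sum>x\<in>cell k d. card (nbrs x \<inter> cell k (Suc d)))"
    using Suc by (intro card_UN_le) auto
  also have "\<dots> \<le> (\<Sum>x\<in>cell k d. Q - 1)" by (rule sum_mono[OF card_x])
  also have "\<dots> \<le> (Q - 1) ^ Suc d" using Suc by simp
  finally show ?case using finite_subset[OF sub fin] by simp
qed

text \<open>Grouped by foot and depth, the cell of \<open>k\<close> and \<open>d\<close> contributes
  at most \<open>t ^ d\<close> times the square of \<open>y k\<close>. Partial sums are therefore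
  bounded by a geometric series times the sum of the squares of \<open>y\<close>.\<close>

lemma profile_l2:
  assumes a: "(real Q - 1) * a\<^sup>2 < 1" and y: "summable (\<lambda>k. (y k)\<^sup>2)"
  shows "(\<lambda>x. complex_of_real (profile a y x)) \<in> l2 (verts G)"
proof -
  define t where "t = (real Q - 1) * a\<^sup>2"
  have t: "0 \<le> t" "t < 1" using a Q by (auto simp: t_def)
  define M where "M = (\<Sum>k. (y k)\<^sup>2) * (\<Sum>d. t ^ d)"
  have bound: "(\<Sum>x\<in>F. (profile a y x)\<^sup>2) \<le> M" if F: "finite F" "F \<subseteq> verts G" for F
  proof -
    let ?T = "base ` F \<times> depth ` F"
    have "(\<Sum>x\<in>F. (profile a y x)\<^sup>2) =
        (\<Sum>kd\<in>?T. \<Sum>x\<in>{x \<in> F. (base x, depth x) = kd}. (profile a y x)\<^sup>2)"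
      using F by (intro sum.group[symmetric]) auto
    also have "\<dots> \<le> (\<Sum>kd\<in>?T. (y (fst kd))\<^sup>2 * t ^ snd kd)"
    proof (rule sum_mono)
      fix kd assume "kd \<in> ?T"
      obtain k d where kd: "kd = (k, d)" by (cases kd)
      let ?C = "{x \<in> F. (base x, depth x) = kd}"
      have "(\<Sum>x\<in>?C. (profile a y x)\<^sup>2) = (\<Sum>x\<in>?C. (a\<^sup>2) ^ d * (y k)\<^sup>2)"
        by (rule sum.cong) (auto simp: kd profile_def power_mult_distrib power_mult[symmetric] mult.commute)
      also have "\<dots> = real (card ?C) * ((a\<^sup>2) ^ d * (y k)\<^sup>2)" by simp
      also have "\<dots> \<le> (real Q - 1) ^ d * ((a\<^sup>2) ^ d * (y k)\<^sup>2)"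
      proof (rule mult_right_mono)
        have "card ?C \<le> card (cell k d)"
          using card_cell[of k d] F by (intro card_mono) (auto simp: cell_def kd)
        also have "\<dots> \<le> (Q - 1) ^ d" using card_cell by simp
        finally have "real (card ?C) \<le> real ((Q - 1) ^ d)" by (rule of_nat_mono)
        then show "real (card ?C) \<le> (real Q - 1) ^ d" using Q by (simp add: of_nat_diff)
      qed simp
      finally show "(\<Sum>x\<in>?C. (profile a y x)\<^sup>2) \<le> (y (fst kd))\<^sup>2 * t ^ snd kd"
        by (simp add: kd t_def power_mult_distrib mult_ac)
    qed
    also have "\<dots> = (\<Sum>k\<in>base ` F. (y k)\<^sup>2) * (\<Sum>d\<in>depth ` F. t ^ d)"
      by (simp add: sum_product sum.cartesian_product split_def)
    also have "\<dots> \<le> M"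
      unfolding M_def using F t y
      by (intro mult_mono sum_le_suminf suminf_nonneg sum_nonneg) (auto intro: summable_geometric)
    finally show ?thesis .
  qed
  have "(\<lambda>x. (profile a y x)\<^sup>2) summable_on verts G"
    by (rule nonneg_bounded_partial_sums_imp_summable_on[where C=M])
      (auto intro!: eventually_finite_subsets_at_top_weakI bound)
  then show ?thesis by (simp add: l2_def)
qed

end

section \<open>The eigenvalue equation along the ray\<close>

text \<open>The smaller root \<open>a\<close> of \<open>a + 1 / a = 1 + 2 * cos t\<close>.\<close>

definition decay :: "real \<Rightarrow> real" where
  "decay t = (1 + 2 * cos t - sqrt ((1 + 2 * cos t)\<^sup>2 - 4)) / 2"

definition decay_star :: real where
  "decay_star = (3 - sqrt 5) / 2"

text \<open>The bound 0.382 is \<open>(3 - 2.236) / 2\<close>; it is sharp enough to settle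
  \<open>Q \<le> 7\<close> later.\<close>

lemma decay_star: "0 < decay_star" "decay_star < 0.382" "1 / decay_star = 3 - decay_star"
proof -
  have s: "2.236 < sqrt 5" "sqrt 5 < (3::real)"
    by (rule real_less_rsqrt real_less_lsqrt; simp add: power2_eq_square)+
  then show "0 < decay_star" "decay_star < 0.382" by (auto simp: decay_star_def)
  then show "1 / decay_star = 3 - decay_star"
    using s by (simp add: decay_star_def field_simps)
qed

lemma decay_0: "decay 0 = decay_star"
  by (simp add: decay_def decay_star_def)

text \<open>The real \<open>sqrt\<close> is continuous on negative arguments too, so the sign of the
  discriminant does not matter here.\<close>

lemma continuous_decay: "continuous_on S decay"
  unfolding decay_def by (intro continuous_intros) auto

text \<open>At \<open>pi / 3\<close> the sum of the roots, \<open>1 + 2 * cos t\<close>, drops to 2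
  and the discriminant vanishes; up to there the roots are real and positive with product 1.\<close>

lemma decay:
  assumes "0 \<le> t" "t \<le> pi / 3"
  shows "0 < decay t" "1 / decay t + decay t = 1 + 2 * cos t" "decay t \<le> 1"
proof -
  define c where "c = 1 + 2 * cos t"
  have "cos (pi / 3) \<le> cos t" using assms pi_gt_zero by (intro cos_monotone_0_pi_le) auto
  then have c: "2 \<le> c" "c \<le> 3" by (auto simp: c_def cos_60)
  have c2: "0 \<le> c\<^sup>2 - 4" using power_mono[OF c(1), of 2] by simp
  define s where "s = sqrt (c\<^sup>2 - 4)"
  have s: "s\<^sup>2 = c\<^sup>2 - 4" "0 \<le> s" using c2 by (auto simp: s_def)
  have d: "decay t = (c - s) / 2" by (simp add: decay_def c_def s_def)
  have "s < c" by (rule power2_less_imp_less) (use s c in auto)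
  then show pos: "0 < decay t" by (simp add: d)
  have "decay t * decay t + 1 = c * decay t"
    using s by (simp add: d field_simps power2_eq_square)
  then show "1 / decay t + decay t = 1 + 2 * cos t"
    using pos unfolding c_def[symmetric] by (simp add: field_simps)
  have "(c - 2)\<^sup>2 \<le> s\<^sup>2" using s c by (simp add: power2_eq_square algebra_simps)
  then have "c - 2 \<le> s" using s(2) by (rule power2_le_imp_le)
  then show "decay t \<le> 1" by (simp add: d)
qed

text \<open>The equation lets the cosine, continued one step past \<open>n\<close>, join the
  decaying tail. The bound on \<open>t\<close> says that \<open>t * (n / 2 + 1)\<close> stays below
  \<open>pi / 2\<close>, so all cosines involved are positive.\<close>

definition critical_angle :: "nat \<Rightarrow> real \<Rightarrow> bool" where
  "critical_angle n t \<longleftrightarrow> 0 < t \<and> t < pi / (real n + 2) \<and>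
     cos (t * (real n / 2 + 1)) = decay t * cos (t * (real n / 2))"

lemma critical_angle_exists:
  assumes "1 \<le> n"
  shows "\<exists>t. critical_angle n t"
proof -
  define f where "f t = decay t * cos (t * (real n / 2)) - cos (t * (real n / 2 + 1))" for t
  define T where "T = pi / (real n + 2)"
  have "T \<le> pi / 3" unfolding T_def using assms by (intro divide_left_mono) auto
  then have T: "0 < T" "T \<le> pi / 3" by (auto simp: T_def)
  \<comment> \<open>At \<open>T\<close> the subtracted cosine in \<open>f\<close> vanishes, so
    \<open>f T\<close> is positive; at 0 both cosines are 1 and \<open>f 0 = decay_star - 1\<close>
    is negative.\<close>
  have Tn: "T * (real n / 2 + 1) = pi / 2" by (simp add: T_def field_simps)
  have "T * (real n / 2) < pi / 2" using T Tn by (simp add: algebra_simps)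
  moreover have "0 \<le> T * (real n / 2)" using T by simp
  ultimately have "0 < cos (T * (real n / 2))" using pi_gt_zero by (intro cos_gt_zero_pi) linarith+
  then have fT: "0 < f T" using decay(1)[of T] T by (simp add: f_def Tn)
  have f0: "f 0 < 0" using decay_star by (simp add: f_def decay_0)
  have "continuous_on {0..T} f"
    unfolding f_def by (intro continuous_intros continuous_decay)
  then obtain t where t: "0 \<le> t" "t \<le> T" "f t = 0"
    using IVT'[of f 0 0 T] f0 fT T by auto
  then have "t \<noteq> 0" "t \<noteq> T" using f0 fT by auto
  then have "critical_angle n t" using t unfolding critical_angle_def f_def T_def by simp
  then show ?thesis ..
qed

text \<open>The cosine is centred at \<open>n / 2\<close> because reversing the looped path is a
  symmetry of the perturbed tree. Both ends get the value 1, so the two branches agree at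
  \<open>k = n\<close>.\<close>

definition chain :: "nat \<Rightarrow> real \<Rightarrow> nat \<Rightarrow> real" where
  "chain n t k = (if k \<le> n then cos (t * (real k - real n / 2)) / cos (t * (real n / 2))
     else decay t ^ (k - n))"

lemma cos_recurrence: "cos (x - t) + cos (x + t) = 2 * cos t * cos (x::real)"
  by (simp add: cos_add cos_diff)

context
  fixes n :: nat and t :: real
  assumes n: "1 \<le> n" and t: "critical_angle n t"
begin

lemma angle_le: "0 < t" "t \<le> pi / 3" "t * (real n / 2) < pi / 2"
proof -
  have tn: "0 < t" "t < pi / (real n + 2)" using t by (auto simp: critical_angle_def)
  show "0 < t" by fact
  have "pi / (real n + 2) \<le> pi / 3" using n by (intro divide_left_mono) auto
  with tn(2) show "t \<le> pi / 3" by linarith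
  have "t * (real n + 2) < pi" using tn by (simp add: field_simps)
  then show "t * (real n / 2) < pi / 2" using tn by (simp add: algebra_simps)
qed

lemmas decay_angle = decay[OF less_imp_le[OF angle_le(1)] angle_le(2)]

lemma cos_half_pos: "0 < cos (t * (real n / 2))"
proof (rule cos_gt_zero_pi)
  have "0 \<le> t * (real n / 2)" using angle_le by simp
  then show "- (pi / 2) < t * (real n / 2)" using pi_gt_zero by linarith
qed (rule angle_le)

lemma chain_0: "chain n t 0 = 1"
  using cos_half_pos by (simp add: chain_def)

lemma chain_ge: "n \<le> k \<Longrightarrow> chain n t k = decay t ^ (k - n)"
  using cos_half_pos by (auto simp: chain_def)

lemma chain_pos: "0 < chain n t k"
proof (cases "k \<le> n")
  case True
  have half: "\<bar>real k - real n / 2\<bar> \<le> real n / 2"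
    using of_nat_mono[OF True, where 'a=real] by linarith
  have "\<bar>t * (real k - real n / 2)\<bar> \<le> t * (real n / 2)"
    using angle_le(1) half unfolding abs_mult by (intro mult_mono) auto
  then have "0 < cos (t * (real k - real n / 2))"
    using angle_le by (intro cos_gt_zero_pi) (auto simp: abs_le_iff)
  then show ?thesis using True cos_half_pos by (simp add: chain_def)
next
  case False
  then show ?thesis using decay_angle by (simp add: chain_def)
qed

text \<open>Since the cosine is even, the matching condition at \<open>n + 1\<close> also gives the
  virtual value \<open>decay t\<close> at index -1. The cosine recurrence at 0 then yields the value
  at 1.\<close>

lemma chain_1: "chain n t 1 = 2 * cos t - decay t"
proof -
  have "cos (- (t * (real n / 2)) - t) + cos (- (t * (real n / 2)) + t)
      = 2 * cos t * cos (- (t * (real n / 2)))"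
    by (rule cos_recurrence)
  moreover have "cos (- (t * (real n / 2)) - t) = cos (t * (real n / 2 + 1))"
    by (metis cos_minus minus_diff_eq diff_minus_eq_add distrib_left mult.right_neutral add.commute)
  moreover have "- (t * (real n / 2)) + t = t * (real 1 - real n / 2)"
    by (simp add: algebra_simps)
  ultimately have "cos (t * (real 1 - real n / 2)) = (2 * cos t - decay t) * cos (t * (real n / 2))"
    using t by (simp add: critical_angle_def left_diff_distrib)
  then show ?thesis using n cos_half_pos by (simp add: chain_def)
qed

lemma chain_recurrence:
  assumes "Suc k \<le> n"
  shows "chain n t k + chain n t (Suc (Suc k)) = 2 * cos t * chain n t (Suc k)"
proof -
  let ?x = "t * (real (Suc k) - real n / 2)"
  have 1: "cos (t * (real k - real n / 2)) + cos (t * (real (Suc (Suc k)) - real n / 2))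
      = 2 * cos t * cos ?x"
    using cos_recurrence[of ?x t] by (simp add: algebra_simps)
  \<comment> \<open>At index \<open>n + 1\<close> the definition takes the tail value
    \<open>decay t\<close>; the critical equation identifies it with the continued cosine.\<close>
  have 2: "chain n t (Suc (Suc k))
      = cos (t * (real (Suc (Suc k)) - real n / 2)) / cos (t * (real n / 2))"
  proof (cases "Suc (Suc k) \<le> n")
    case False
    then have k: "Suc k = n" using assms by simp
    then have "real (Suc (Suc k)) - real n / 2 = real n / 2 + 1" by (simp add: field_simps)
    then show ?thesis
      using t cos_half_pos chain_ge[of "Suc (Suc k)"] k by (simp add: critical_angle_def)
  qed (simp add: chain_def)
  have 3: "chain n t k = cos (t * (real k - real n / 2)) / cos (t * (real n / 2))"
    "chain n t (Suc k) = cos ?x / cos (t * (real n / 2))"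
    using assms by (auto simp: chain_def)
  show ?thesis
    unfolding 2 3 add_divide_distrib[symmetric] 1 by simp
qed

lemma chain_tail:
  assumes "n \<le> k"
  shows "chain n t k + chain n t (Suc (Suc k)) = (1 / decay t + decay t) * chain n t (Suc k)"
  using assms decay_angle(1)
  by (simp add: chain_ge Suc_diff_le field_simps)

lemma chain_summable:
  assumes "decay t < 1"
  shows "summable (\<lambda>k. (chain n t k)\<^sup>2)"
proof -
  have "(decay t)\<^sup>2 < 1" using assms decay_angle by (simp add: power_less_one_iff)
  then have "summable (\<lambda>k. ((decay t)\<^sup>2) ^ k)" by (intro summable_geometric) simp
  then have "summable (\<lambda>k. (chain n t (k + n))\<^sup>2)"
    by (simp add: chain_ge power_mult[symmetric] mult.commute)
  then show ?thesis by (subst (asm) summable_iff_shift)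
qed

end

section \<open>Limits of angle, decay factor and chain\<close>

definition angle :: "nat \<Rightarrow> real" where
  "angle n = (SOME t. critical_angle n t)"

lemma critical_angle: "1 \<le> n \<Longrightarrow> critical_angle n (angle n)"
  unfolding angle_def by (rule someI_ex) (rule critical_angle_exists)

lemma angle_tendsto: "angle \<longlonglongrightarrow> 0"
proof (rule tendsto_sandwich)
  show "\<forall>\<^sub>F n in sequentially. 0 \<le> angle n"
    using eventually_ge_at_top[of 1]
    by eventually_elim (use critical_angle in \<open>force simp: critical_angle_def\<close>)
  show "\<forall>\<^sub>F n in sequentially. angle n \<le> pi / (real n + 2)"
    using eventually_ge_at_top[of 1]
    by eventually_elim (use critical_angle in \<open>force simp: critical_angle_def\<close>)
  show "(\<lambda>n. pi / (real n + 2)) \<longlonglongrightarrow> 0" by real_asymp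
qed simp

lemma decay_tendsto: "(\<lambda>n. decay (angle n)) \<longlonglongrightarrow> decay_star"
proof -
  have "isCont decay 0"
    using continuous_decay[of UNIV] by (simp add: continuous_on_eq_continuous_at)
  then show ?thesis using isCont_tendsto_compose[OF _ angle_tendsto] decay_0 by metis
qed

lemma chain_tendsto:
  "(\<lambda>n. chain n (angle n) k) \<longlonglongrightarrow> real k * (1 - decay_star) + 1"
proof -
  have cos: "(\<lambda>n. cos (angle n)) \<longlonglongrightarrow> 1" using tendsto_cos[OF angle_tendsto] by simp
  \<comment> \<open>Two consecutive limits are carried along because the recurrence has three terms.
    In the limit it reads \<open>y (k + 2) = 2 * y (k + 1) - y k\<close> with \<open>y 0 = 1\<close>
    and \<open>y 1 = 2 - decay_star\<close>, whose solution is affine.\<close>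
  have "((\<lambda>n. chain n (angle n) k) \<longlonglongrightarrow> real k * (1 - decay_star) + 1) \<and>
    ((\<lambda>n. chain n (angle n) (Suc k)) \<longlonglongrightarrow> real (Suc k) * (1 - decay_star) + 1)"
  proof (induction k)
    case 0
    have "\<forall>\<^sub>F n in sequentially. chain n (angle n) 0 = 1"
      using eventually_ge_at_top[of 1] by eventually_elim (use chain_0 critical_angle in blast)
    moreover have "\<forall>\<^sub>F n in sequentially. chain n (angle n) 1 = 2 * cos (angle n) - decay (angle n)"
      using eventually_ge_at_top[of 1] by eventually_elim (use chain_1 critical_angle in blast)
    moreover have "(\<lambda>n. 2 * cos (angle n) - decay (angle n)) \<longlonglongrightarrow> 2 * 1 - decay_star"
      by (intro tendsto_intros cos decay_tendsto)
    ultimately show ?case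
      by (auto simp: tendsto_cong tendsto_eventually)
  next
    case (Suc k)
    have "\<forall>\<^sub>F n in sequentially. chain n (angle n) (Suc (Suc k)) =
        2 * cos (angle n) * chain n (angle n) (Suc k) - chain n (angle n) k"
      using eventually_ge_at_top[of "Suc k"]
      by eventually_elim (use chain_recurrence critical_angle in \<open>force simp: eq_diff_eq add.commute\<close>)
    moreover have "(\<lambda>n. 2 * cos (angle n) * chain n (angle n) (Suc k) - chain n (angle n) k) \<longlonglongrightarrow>
        2 * 1 * (real (Suc k) * (1 - decay_star) + 1) - (real k * (1 - decay_star) + 1)"
      using Suc by (intro tendsto_intros cos) auto
    moreover have "2 * 1 * (real (Suc k) * (1 - decay_star) + 1) - (real k * (1 - decay_star) + 1)
        = real (Suc (Suc k)) * (1 - decay_star) + 1"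
      by (simp add: algebra_simps)
    ultimately have "(\<lambda>n. chain n (angle n) (Suc (Suc k))) \<longlonglongrightarrow> real (Suc (Suc k)) * (1 - decay_star) + 1"
      by (simp only: tendsto_cong)
    then show ?case using Suc by blast
  qed
  then show ?thesis by simp
qed

section \<open>Perron Frobenius eigenvectors of the perturbed trees\<close>

context tree_with_ray
begin

lemma ray_profile_pos:
  assumes "0 < a" "\<And>k. 0 < y k"
  shows "0 < profile a y x"
  using assms by (simp add: profile_def)

definition energy :: "real \<Rightarrow> real" where
  "energy a = 1 / a + (real Q - 1) * a"

lemma energy_pos: "0 < a \<Longrightarrow> 0 < energy a"
  using Q by (auto simp: energy_def intro!: add_pos_nonneg)

text \<open>The same vector bounds the norm from both sides: positivity gives the upper bound by the
  Schur test, square summability makes it a test function for the lower one.\<close>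

lemma PF_perturbed:
  assumes n: "1 \<le> n" and t: "critical_angle n t" and small: "(real Q - 1) * (decay t)\<^sup>2 < 1"
  shows "normalized_l2_PF (graph_Y G p n) (p 0) (profile (decay t) (chain n t))"
    and "op_norm (verts G) (adjacency (graph_Y G p n)) = energy (decay t)"
proof -
  let ?a = "decay t" and ?y = "chain n t" and ?B = "adjacency (graph_Y G p n)"
  let ?v = "profile ?a ?y" and ?l = "energy ?a" and ?R = "L.row (p ` {0..n})"
  have B: "?B = adjacency (add_loops G (p ` {0..n}))" by (simp add: graph_Y_def)
  note a = decay_angle[OF n t]
  \<comment> \<open>The subtracted 1 is the weight of the loop, moved to the other side of the
    eigenvalue equation.\<close>
  have cos: "2 * cos t = 1 / ?a + ?a - 1" using a by simp
  have l: "0 < ?l" using a energy_pos by simp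
  have v: "0 < ?v x" for x by (rule ray_profile_pos[OF a(1) chain_pos[OF n t]])
  have eig: "(\<Sum>z\<in>?R x. ?B x z * ?v z) = ?l * ?v x" if "x \<in> verts G" for x
    unfolding B
  proof (rule profile_eigenvector)
    show "?y 1 + (real Q - 1) * ?a * ?y 0 + (if 0 \<in> {0..n} then ?y 0 else 0) = ?l * ?y 0"
      using chain_0[OF n t] chain_1[OF n t] cos by (simp add: energy_def)
    fix k
    show "?y k + ?y (Suc (Suc k)) + (real Q - 2) * ?a * ?y (Suc k) +
        (if Suc k \<in> {0..n} then ?y (Suc k) else 0) = ?l * ?y (Suc k)"
    proof (cases "Suc k \<le> n")
      case True
      then show ?thesis
        using chain_recurrence[OF n t True] unfolding cos by (simp add: energy_def algebra_simps)
    next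
      case False
      then have "?y k + ?y (Suc (Suc k)) = (1 / ?a + ?a) * ?y (Suc k)"
        using chain_tail[OF n t, of k] by simp
      then show ?thesis using False by (simp add: energy_def algebra_simps)
    qed
  qed (use a that in \<open>auto simp: energy_def\<close>)
  \<comment> \<open>Strict decay makes the tail along the ray square summable; \<open>small\<close>
    excludes the boundary value 1.\<close>
  have a1: "?a < 1"
  proof (rule ccontr)
    assume "\<not> ?a < 1"
    then have "?a = 1" using a by simp
    then show False using small Q by simp
  qed
  have l2: "(\<lambda>x. complex_of_real (?v x)) \<in> l2 (verts G)"
    by (rule profile_l2[OF small chain_summable[OF n t a1]])
  have bdd: "l2_bounded (verts G) ?B" and le: "op_norm (verts G) ?B \<le> ?l"
    using L.schur_test[of ?v "p ` {0..n}" ?l] v eig l by (auto simp: B)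
  have "?l \<le> op_norm (verts G) ?B"
    unfolding B
    by (rule L.op_norm_lower[where u = ?v and r = "p 0"])
      (use bdd v l2 eig l chain_0[OF n t] in \<open>auto simp: B intro: less_imp_le\<close>)
  with le show norm: "op_norm (verts G) ?B = ?l" by simp
  have "((\<lambda>y. ?B x y * ?v y) has_sum (?l * ?v x)) (verts G)" if "x \<in> verts G" for x
    using L.has_sum_row_real[OF that, of "p ` {0..n}" ?v] eig[OF that] by (simp add: B)
  then have "PF_eigenvector (verts G) ?B ?v"
    using bdd v L.nonneg unfolding PF_eigenvector_def norm by (auto simp: B)
  then show "normalized_l2_PF (graph_Y G p n) (p 0) ?v"
    using l2 chain_0[OF n t] by (simp add: normalized_l2_PF_def graph_Y_def)
qed

section \<open>The limit for \<open>Q\<close> at most 7\<close>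

context
  assumes Q7: "Q \<le> 7"
begin

text \<open>Six times the square of 0.382 is about 0.876. For \<open>Q = 8\<close> the corresponding
  product already exceeds 1.\<close>

lemma decay_star_small: "(real Q - 1) * decay_star\<^sup>2 < 1"
proof -
  have "decay_star\<^sup>2 < 0.382\<^sup>2" using decay_star by (intro power_strict_mono) auto
  then have "(real Q - 1) * decay_star\<^sup>2 \<le> 6 * 0.382\<^sup>2" using Q Q7 by (intro mult_mono) auto
  then show ?thesis by (simp add: power2_eq_square)
qed

text \<open>With \<open>1 / a = 3 - a\<close> the energy becomes
  \<open>3 + (Q - 2) * a\<close>.\<close>

lemma energy_decay_star: "energy decay_star = lambda_star Q"
  by (simp add: energy_def decay_star(3)) (simp add: decay_star_def lambda_star_def field_simps)

text \<open>\<open>a_fun\<close> is the smaller root \<open>a\<close> of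
  \<open>1 / a + q * a = l\<close>. For \<open>l = lambda_star Q\<close> the discriminant is the
  square of \<open>1 / decay_star - q * decay_star\<close>, whose sign, given by
  \<open>decay_star_small\<close>, makes \<open>decay_star\<close> the smaller root.\<close>

lemma a_fun_lambda_star: "a_fun Q (lambda_star Q) = decay_star"
proof -
  have a: "0 < decay_star" "decay_star < 1" using decay_star by auto
  define q where "q = real Q - 1"
  have q: "1 \<le> q" using Q by (simp add: q_def)
  have l: "lambda_star Q = 1 / decay_star + q * decay_star" by (simp add: energy_decay_star[symmetric] energy_def q_def)
  have lpos: "0 < lambda_star Q" using energy_pos[OF a(1)] by (simp add: energy_decay_star)
  have gap: "0 \<le> 1 / decay_star - q * decay_star"
    using decay_star_small a by (simp add: q_def field_simps power2_eq_square)
  have "1 - 4 * q / (lambda_star Q)\<^sup>2 = ((1 / decay_star - q * decay_star) / lambda_star Q)\<^sup>2"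
  proof -
    have "(lambda_star Q)\<^sup>2 - 4 * q = (1 / decay_star - q * decay_star)\<^sup>2"
      using a by (simp add: l power2_sum power2_diff power_divide)
    then show ?thesis using lpos by (simp add: power_divide diff_divide_distrib[symmetric] divide_simps)
  qed
  then have "sqrt (1 - 4 * q / (lambda_star Q)\<^sup>2) = (1 / decay_star - q * decay_star) / lambda_star Q"
    using gap lpos by simp
  then have "a_fun Q (lambda_star Q) = (1 - (1 / decay_star - q * decay_star) / lambda_star Q) / (2 * q / lambda_star Q)"
    by (simp add: a_fun_def q_def)
  also have "\<dots> = (lambda_star Q - (1 / decay_star - q * decay_star)) / (2 * q)"
    using lpos q by (simp add: divide_simps)
  also have "\<dots> = decay_star" using q by (simp add: l)
  finally show ?thesis .
qed

lemma limit_weight_profile: "limit_weight Q G p = profile decay_star (\<lambda>k. real k * (1 - decay_star) + 1)"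
  by (rule ext) (simp only: limit_weight_def profile_def a_fun_lambda_star)

lemma eventually_decay_small:
  "\<forall>\<^sub>F n in sequentially. 1 \<le> n \<and> (real Q - 1) * (decay (angle n))\<^sup>2 < 1"
proof -
  have "(\<lambda>n. (real Q - 1) * (decay (angle n))\<^sup>2) \<longlonglongrightarrow> (real Q - 1) * decay_star\<^sup>2"
    by (intro tendsto_intros decay_tendsto)
  then have "\<forall>\<^sub>F n in sequentially. (real Q - 1) * (decay (angle n))\<^sup>2 < 1"
    using decay_star_small by (rule order_tendstoD)
  then show ?thesis using eventually_ge_at_top[of 1] by eventually_elim simp
qed

lemma perturbed_PF_exists_unique:
  "\<forall>\<^sub>F n in sequentially. \<exists>v. normalized_l2_PF (graph_Y G p n) (p 0) v \<and>
     (\<forall>w. normalized_l2_PF (graph_Y G p n) (p 0) w \<longrightarrow> (\<forall>x\<in>verts G. w x = v x))"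
proof -
  show ?thesis
    using eventually_decay_small
  proof eventually_elim
    case (elim n)
    then have "normalized_l2_PF (graph_Y G p n) (p 0) (profile (decay (angle n)) (chain n (angle n)))"
      using PF_perturbed critical_angle by blast
    then show ?case using normalized_l2_PF_unique unfolding graph_Y_def by blast
  qed
qed

text \<open>By uniqueness \<open>v n\<close> is eventually the explicit profile on the vertices,
  whose two factors converge.\<close>

lemma perturbed_PF_tendsto:
  assumes v: "\<forall>\<^sub>F n in sequentially. normalized_l2_PF (graph_Y G p n) (p 0) (v n)"
    and x: "x \<in> verts G"
  shows "(\<lambda>n. v n x) \<longlonglongrightarrow> limit_weight Q G p x"
proof -
  have "\<forall>\<^sub>F n in sequentially. v n x = profile (decay (angle n)) (chain n (angle n)) x"
    using v eventually_decay_small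
  proof eventually_elim
    case (elim n)
    then have "normalized_l2_PF (graph_Y G p n) (p 0) (profile (decay (angle n)) (chain n (angle n)))"
      using PF_perturbed critical_angle by blast
    then show ?case using elim normalized_l2_PF_unique x unfolding graph_Y_def by blast
  qed
  moreover have "(\<lambda>n. profile (decay (angle n)) (chain n (angle n)) x) \<longlonglongrightarrow> limit_weight Q G p x"
    unfolding limit_weight_profile profile_def
    by (intro tendsto_intros decay_tendsto chain_tendsto)
  ultimately show ?thesis by (simp add: tendsto_cong)
qed

text \<open>The weight grows linearly along the ray, so it is not square summable and bounds the
  norm only from above. The lower bound comes from the eigenvectors of \<open>graph_Y\<close> as
  test functions, whose eigenvalues tend to \<open>energy decay_star\<close>.\<close>

lemma limit_weight_PF:
  "PF_eigenvector (verts (graph_H G p)) (adjacency (graph_H G p)) (limit_weight Q G p)"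
proof -
  let ?y = "\<lambda>k. real k * (1 - decay_star) + 1"
  let ?v = "profile decay_star ?y" and ?B = "adjacency (graph_H G p)"
  have B: "?B = adjacency (add_loops G (p ` UNIV))" by (simp add: graph_H_def)
  have a: "0 < decay_star" "decay_star < 1" using decay_star by auto
  have l: "0 < energy decay_star" by (rule energy_pos[OF a(1)])
  have inv: "1 / decay_star = 3 - decay_star" by (rule decay_star)
  have v: "0 < ?v x" for x
    using a by (intro ray_profile_pos) (auto intro!: add_nonneg_pos)
  have eig: "(\<Sum>z\<in>L.row (range p) x. ?B x z * ?v z) = energy decay_star * ?v x" if "x \<in> verts G" for x
    unfolding B
  proof (rule profile_eigenvector)
    show "?y 1 + (real Q - 1) * decay_star * ?y 0 + (if 0 \<in> UNIV then ?y 0 else 0)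
        = energy decay_star * ?y 0"
      unfolding energy_def inv by (simp add: algebra_simps)
    show "?y k + ?y (Suc (Suc k)) + (real Q - 2) * decay_star * ?y (Suc k)
        + (if Suc k \<in> UNIV then ?y (Suc k) else 0) = energy decay_star * ?y (Suc k)" for k
      unfolding energy_def inv by (simp add: algebra_simps)
  qed (use a that in \<open>auto simp: energy_def\<close>)
  have bdd: "l2_bounded (verts G) ?B" and le: "op_norm (verts G) ?B \<le> energy decay_star"
    using L.schur_test[of ?v "range p" "energy decay_star"] v eig l by (auto simp: B)
  have "\<forall>\<^sub>F n in sequentially. energy (decay (angle n)) \<le> op_norm (verts G) ?B"
    using eventually_decay_small
  proof eventually_elim
    case (elim n)
    let ?u = "profile (decay (angle n)) (chain n (angle n))" and ?S = "p ` {0..n}"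
    have tn: "critical_angle n (angle n)" using critical_angle elim by blast
    have PF: "normalized_l2_PF (add_loops G ?S) (p 0) ?u"
      "op_norm (verts G) (adjacency (add_loops G ?S)) = energy (decay (angle n))"
      using PF_perturbed[OF _ tn] elim by (auto simp: graph_Y_def)
    have u: "0 < ?u x" if "x \<in> verts G" for x
      using PF that by (simp add: normalized_l2_PF_def PF_eigenvector_def)
    show ?case
      unfolding B
    proof (rule L.op_norm_lower[where u = ?u and r = "p 0"])
      fix x assume x: "x \<in> verts G"
      have "energy (decay (angle n)) * ?u x =
          (\<Sum>y\<in>L.row ?S x. adjacency (add_loops G ?S) x y * ?u y)"
        using PF x by (intro has_sum_unique[OF _ L.has_sum_row_real[OF x]])
          (auto simp: normalized_l2_PF_def PF_eigenvector_def)
      \<comment> \<open>Enlarging the loop set only adds nonnegative terms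
        \<open>?u x\<close>.\<close>
      also have "\<dots> \<le> (\<Sum>y\<in>L.row (range p) x. adjacency (add_loops G (range p)) x y * ?u y)"
        unfolding sum_row_loops[OF x] using u[OF x] by auto
      finally show "energy (decay (angle n)) * ?u x
        \<le> (\<Sum>y\<in>L.row (range p) x. adjacency (add_loops G (range p)) x y * ?u y)" .
      show "0 \<le> ?u x" using u[OF x] by simp
    next
      show "0 \<le> energy (decay (angle n))"
        using energy_pos decay_angle(1)[OF _ tn] elim by (simp add: less_imp_le)
    qed (use bdd PF in \<open>auto simp: B normalized_l2_PF_def\<close>)
  qed
  moreover have "(\<lambda>n. energy (decay (angle n))) \<longlonglongrightarrow> energy decay_star"
    unfolding energy_def using a by (intro tendsto_intros decay_tendsto) auto
  ultimately have "energy decay_star \<le> op_norm (verts G) ?B"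
    by (intro tendsto_upperbound[where F=sequentially]) auto
  with le have norm: "op_norm (verts G) ?B = energy decay_star" by simp
  have "((\<lambda>y. ?B x y * ?v y) has_sum (energy decay_star * ?v x)) (verts G)" if "x \<in> verts G" for x
    using L.has_sum_row_real[OF that, of "range p" ?v] eig[OF that] by (simp add: B)
  then have "PF_eigenvector (verts G) ?B ?v"
    using bdd v L.nonneg unfolding PF_eigenvector_def norm by (auto simp: B)
  then show ?thesis by (simp add: limit_weight_profile graph_H_def)
qed

end

end

theorem theorem5p2:
  fixes Q :: nat and G :: "'a ugraph" and p :: "nat \<Rightarrow> 'a"
  assumes "2 \<le> Q" and "Q \<le> 7"
    and "homogeneous_tree Q G"
    and "ray G p"
  shows "(\<forall>\<^sub>F n in sequentially. \<exists>v. normalized_l2_PF (graph_Y G p n) (p 0) v \<and>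
            (\<forall>w. normalized_l2_PF (graph_Y G p n) (p 0) w \<longrightarrow> (\<forall>x\<in>verts G. w x = v x))) \<and>
         (\<forall>v :: nat \<Rightarrow> 'a \<Rightarrow> real.
            (\<forall>\<^sub>F n in sequentially. normalized_l2_PF (graph_Y G p n) (p 0) (v n)) \<longrightarrow>
            (\<forall>x\<in>verts G. (\<lambda>n. v n x) \<longlonglongrightarrow> limit_weight Q G p x)) \<and>
         PF_eigenvector (verts (graph_H G p)) (adjacency (graph_H G p)) (limit_weight Q G p)"
proof -
  interpret tree_with_ray Q G p by unfold_locales (use assms in auto)
  show ?thesis
    using perturbed_PF_exists_unique perturbed_PF_tendsto limit_weight_PF assms(2) by blast
qed

end
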